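(* Let $(M,h,\nabla)$ be a quasi-statistical manifold with $h$ symmetric or skew-symmetric, let $(\hat h,\hat\nabla)$ be the induced generalized quasi-statistical structure on $TM\oplus T^*M$, and let $\hat\nabla^*$ be the dual connection of $\hat\nabla$ with respect to $\hat h$. Then for all vector fields $X,Y,Z$ and 1-forms $\alpha,\beta,\gamma$ on $M$, $$R^{\hat\nabla}(X+\alpha,Y+\beta)(Z+\gamma)=R^\nabla(X,Y)Z+h(R^\nabla(X,Y)h^{-1}(\gamma)),$$ $$R^{\hat\nabla^*}(X+\alpha,Y+\beta)(Z+\gamma)=h^{-1}(R^\nabla(X,Y)h(Z))+R^\nabla(X,Y)\gamma,$$ where $R^\nabla$ is the curvature operator of $\nabla$ (acting on vector fields and on 1-forms). In particular, $\hat\nabla$ and its dual $\hat\nabla^*$ are flat if and only if $\nabla$ is flat.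
   Context: $\nabla$ is an affine connection on the smooth manifold $M$, possibly with torsion $T^\nabla(X,Y)=\nabla_XY-\nabla_YX-[X,Y]$, acting on 1-forms by $(\nabla_X\beta)(Y)=X(\beta(Y))-\beta(\nabla_XY)$. $R^\nabla(X,Y)=\nabla_X\nabla_Y-\nabla_Y\nabla_X-\nabla_{[X,Y]}$ on vector fields and on 1-forms. $h$ is a non-degenerate $(0,2)$-tensor field; $h$ also denotes the isomorphism $TM\to T^*M$, $h(X)=h(X,\cdot)$, with inverse $h^{-1}$. $(M,h,\nabla)$ is a quasi-statistical manifold if $(\nabla_Xh)(Y,Z)-(\nabla_Yh)(X,Z)+h(T^\nabla(X,Y),Z)=0$ for all $X,Y,Z$. On $TM\oplus T^*M$: $[X+\alpha,Y+\beta]_\nabla=[X,Y]+\nabla_X\beta-\nabla_Y\alpha$; $\hat h(X+\alpha,Y+\beta)=-\frac12(\alpha(Y)+\beta(X))$ if $h$ is symmetric, $\hat h(X+\alpha,Y+\beta)=-\frac12(\alpha(Y)-\beta(X))$ if $h$ is skew-symmetric; $\hat\nabla_{X+\alpha}(Y+\beta)=\nabla_XY+h(\nabla_X(h^{-1}(\beta)))$; $\hat\nabla^*$ is defined by $\hat h(\tau,\hat\nabla^*_{X+\alpha}\nu)=X(\hat h(\tau,\nu))-\hat h(\hat\nabla_{X+\alpha}\tau,\nu)$ for all sections $\tau,\nu$. For an affine connection $D$ on $TM\oplus T^*M$ (function-linear in the lower slot, Leibniz in the other with $(X+\alpha)(f)=X(f)$), $R^D(\sigma,\tau)\nu=D_\sigma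 D_\tau\nu-D_\tau D_\sigma\nu-D_{[\sigma,\tau]_\nabla}\nu$. A connection is flat if its curvature operator vanishes. *)

theory Defs
  imports "HOL-Analysis.Analysis" "HOL-Library.Function_Algebras"
begin

text \<open>
  Functions, tangent vectors, vector fields, 1-forms and sections of \<open>TM \<oplus> T*M\<close> are added and
  subtracted with the pointwise operations of \<open>Function_Algebras\<close> and \<open>Product_Plus\<close>.
\<close>

section \<open>Smooth manifolds\<close>

primrec Ck_on :: "nat \<Rightarrow> 'e::real_normed_vector set \<Rightarrow> ('e \<Rightarrow> 'f::real_normed_vector) \<Rightarrow> bool" where
  "Ck_on 0 S f \<longleftrightarrow> continuous_on S f"
| "Ck_on (Suc k) S f \<longleftrightarrow>
     (\<forall>x\<in>S. f differentiable (at x)) \<and> (\<forall>v. Ck_on k S (\<lambda>x. frechet_derivative f (at x) v))"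

text \<open>Only used for open \<open>S\<close> in a finite-dimensional space.\<close>

definition smooth_on :: "'e::real_normed_vector set \<Rightarrow> ('e \<Rightarrow> 'f::real_normed_vector) \<Rightarrow> bool" where
  "smooth_on S f \<longleftrightarrow> (\<forall>k. Ck_on k S f)"

type_synonym ('a, 'n) chart = "'a set \<times> ('a \<Rightarrow> real^'n)"

definition is_chart :: "('a::topological_space, 'n::finite) chart \<Rightarrow> bool" where
  "is_chart = (\<lambda>(U, \<phi>). open U \<and> open (\<phi> ` U) \<and> homeomorphism U (\<phi> ` U) \<phi> (inv_into U \<phi>))"

text \<open>The manifold is the whole type \<open>'a\<close>; its topology is that of the type class.\<close>

definition smooth_manifold ::
    "('a::{t2_space, second_countable_topology}, 'n::finite) chart set \<Rightarrow> bool" where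
  "smooth_manifold A \<longleftrightarrow>
     (\<forall>c\<in>A. is_chart c) \<and> (\<Union>(U, \<phi>)\<in>A. U) = UNIV \<and>
     (\<forall>(U, \<phi>)\<in>A. \<forall>(V, \<psi>)\<in>A. smooth_on (\<phi> ` (U \<inter> V)) (\<psi> \<circ> inv_into U \<phi>))"

definition smooth_functions :: "('a, 'n::finite) chart set \<Rightarrow> ('a \<Rightarrow> real) set" where
  "smooth_functions A = {f. \<forall>(U, \<phi>)\<in>A. smooth_on (\<phi> ` U) (f \<circ> inv_into U \<phi>)}"

section \<open>Tangent vectors, vector fields, 1-forms and tensor fields\<close>

type_synonym 'a tvec = "('a \<Rightarrow> real) \<Rightarrow> real"
type_synonym 'a covec = "'a tvec \<Rightarrow> real"
type_synonym 'a vfield = "'a \<Rightarrow> 'a tvec"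
type_synonym 'a oneform = "'a \<Rightarrow> 'a covec"
type_synonym 'a tensor02 = "'a \<Rightarrow> 'a tvec \<Rightarrow> 'a covec"

text \<open>
  Tangent vectors at \<open>p\<close> are the derivations at \<open>p\<close> of the algebra of smooth functions.  Derivations,
  covectors and bilinear forms are partial objects; they are set to 0 outside their domain, so that
  equality of HOL functions is equality of these objects.
\<close>

definition tangent_space :: "('a, 'n::finite) chart set \<Rightarrow> 'a \<Rightarrow> 'a tvec set" where
  "tangent_space A p = {v.
     (\<forall>f\<in>smooth_functions A. \<forall>g\<in>smooth_functions A. v (f + g) = v f + v g) \<and>
     (\<forall>c. \<forall>f\<in>smooth_functions A. v (\<lambda>q. c * f q) = c * v f) \<and>
     (\<forall>f\<in>smooth_functions A. \<forall>g\<in>smooth_functions A. v (f * g) = v f * g p + f p * v g) \<and>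
     (\<forall>f. f \<notin> smooth_functions A \<longrightarrow> v f = 0)}"

definition cotangent_space :: "('a, 'n::finite) chart set \<Rightarrow> 'a \<Rightarrow> 'a covec set" where
  "cotangent_space A p = {\<omega>.
     (\<forall>v\<in>tangent_space A p. \<forall>w\<in>tangent_space A p. \<omega> (v + w) = \<omega> v + \<omega> w) \<and>
     (\<forall>c. \<forall>v\<in>tangent_space A p. \<omega> (\<lambda>f. c * v f) = c * \<omega> v) \<and>
     (\<forall>v. v \<notin> tangent_space A p \<longrightarrow> \<omega> v = 0)}"

definition vf_apply :: "'a vfield \<Rightarrow> ('a \<Rightarrow> real) \<Rightarrow> 'a \<Rightarrow> real" where
  "vf_apply X f = (\<lambda>p. X p f)"

definition vector_fields :: "('a, 'n::finite) chart set \<Rightarrow> 'a vfield set" where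
  "vector_fields A = {X. (\<forall>p. X p \<in> tangent_space A p) \<and>
     (\<forall>f\<in>smooth_functions A. vf_apply X f \<in> smooth_functions A)}"

definition form_apply :: "'a oneform \<Rightarrow> 'a vfield \<Rightarrow> 'a \<Rightarrow> real" where
  "form_apply \<omega> X = (\<lambda>p. \<omega> p (X p))"

definition one_forms :: "('a, 'n::finite) chart set \<Rightarrow> 'a oneform set" where
  "one_forms A = {\<omega>. (\<forall>p. \<omega> p \<in> cotangent_space A p) \<and>
     (\<forall>X\<in>vector_fields A. form_apply \<omega> X \<in> smooth_functions A)}"

definition tensor_apply :: "'a tensor02 \<Rightarrow> 'a vfield \<Rightarrow> 'a vfield \<Rightarrow> 'a \<Rightarrow> real" where
  "tensor_apply h X Y = (\<lambda>p. h p (X p) (Y p))"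

definition tensor_fields02 :: "('a, 'n::finite) chart set \<Rightarrow> 'a tensor02 set" where
  "tensor_fields02 A = {h.
     (\<forall>p. \<forall>v\<in>tangent_space A p. h p v \<in> cotangent_space A p) \<and>
     (\<forall>p. \<forall>v\<in>tangent_space A p. \<forall>w\<in>tangent_space A p. h p (v + w) = h p v + h p w) \<and>
     (\<forall>p. \<forall>c. \<forall>v\<in>tangent_space A p. h p (\<lambda>f. c * v f) = (\<lambda>w. c * h p v w)) \<and>
     (\<forall>p. \<forall>v. v \<notin> tangent_space A p \<longrightarrow> h p v = 0) \<and>
     (\<forall>X\<in>vector_fields A. \<forall>Y\<in>vector_fields A. tensor_apply h X Y \<in> smooth_functions A)}"

definition nondegenerate :: "('a, 'n::finite) chart set \<Rightarrow> 'a tensor02 \<Rightarrow> bool" where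
  "nondegenerate A h \<longleftrightarrow>
     (\<forall>p. \<forall>v\<in>tangent_space A p. (\<forall>w\<in>tangent_space A p. h p v w = 0) \<longrightarrow> v = 0)"

definition symmetric_tensor :: "('a, 'n::finite) chart set \<Rightarrow> 'a tensor02 \<Rightarrow> bool" where
  "symmetric_tensor A h \<longleftrightarrow>
     (\<forall>p. \<forall>v\<in>tangent_space A p. \<forall>w\<in>tangent_space A p. h p v w = h p w v)"

definition skew_symmetric_tensor :: "('a, 'n::finite) chart set \<Rightarrow> 'a tensor02 \<Rightarrow> bool" where
  "skew_symmetric_tensor A h \<longleftrightarrow>
     (\<forall>p. \<forall>v\<in>tangent_space A p. \<forall>w\<in>tangent_space A p. h p v w = - h p w v)"

text \<open>The bundle map \<open>TM \<rightarrow> T*M\<close> induced by \<open>h\<close>, acting on sections, and its inverse.\<close>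

definition flat :: "'a tensor02 \<Rightarrow> 'a vfield \<Rightarrow> 'a oneform" where
  "flat h X = (\<lambda>p. h p (X p))"

definition sharp ::
    "('a, 'n::finite) chart set \<Rightarrow> 'a tensor02 \<Rightarrow> 'a oneform \<Rightarrow> 'a vfield" where
  "sharp A h \<omega> = (\<lambda>p. inv_into (tangent_space A p) (h p) (\<omega> p))"

definition lie_bracket :: "'a vfield \<Rightarrow> 'a vfield \<Rightarrow> 'a vfield" where
  "lie_bracket X Y = (\<lambda>p f. X p (vf_apply Y f) - Y p (vf_apply X f))"

section \<open>Affine connections\<close>

definition scale_vf :: "('a \<Rightarrow> real) \<Rightarrow> 'a vfield \<Rightarrow> 'a vfield" where
  "scale_vf f X = (\<lambda>p g. f p * X p g)"

definition affine_connection ::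
    "('a, 'n::finite) chart set \<Rightarrow> ('a vfield \<Rightarrow> 'a vfield \<Rightarrow> 'a vfield) \<Rightarrow> bool" where
  "affine_connection A nabla \<longleftrightarrow>
     (\<forall>X\<in>vector_fields A. \<forall>Y\<in>vector_fields A. nabla X Y \<in> vector_fields A) \<and>
     (\<forall>X\<in>vector_fields A. \<forall>Y\<in>vector_fields A. \<forall>Z\<in>vector_fields A.
        nabla (X + Y) Z = nabla X Z + nabla Y Z \<and>
        nabla X (Y + Z) = nabla X Y + nabla X Z) \<and>
     (\<forall>f\<in>smooth_functions A. \<forall>X\<in>vector_fields A. \<forall>Y\<in>vector_fields A.
        nabla (scale_vf f X) Y = scale_vf f (nabla X Y) \<and>
        nabla X (scale_vf f Y) = scale_vf (vf_apply X f) Y + scale_vf f (nabla X Y))"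

definition nabla_form ::
    "('a, 'n::finite) chart set \<Rightarrow> ('a vfield \<Rightarrow> 'a vfield \<Rightarrow> 'a vfield) \<Rightarrow>
       'a vfield \<Rightarrow> 'a oneform \<Rightarrow> 'a oneform" where
  "nabla_form A nabla X \<beta> = (THE \<omega>. \<omega> \<in> one_forms A \<and>
     (\<forall>Y\<in>vector_fields A.
        form_apply \<omega> Y = vf_apply X (form_apply \<beta> Y) - form_apply \<beta> (nabla X Y)))"

definition nabla_tensor ::
    "('a vfield \<Rightarrow> 'a vfield \<Rightarrow> 'a vfield) \<Rightarrow> 'a vfield \<Rightarrow> 'a tensor02 \<Rightarrow>
       'a vfield \<Rightarrow> 'a vfield \<Rightarrow> 'a \<Rightarrow> real" where
  "nabla_tensor nabla X h Y Z =
     vf_apply X (tensor_apply h Y Z) - tensor_apply h (nabla X Y) Z - tensor_apply h Y (nabla X Z)"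

definition torsion ::
    "('a vfield \<Rightarrow> 'a vfield \<Rightarrow> 'a vfield) \<Rightarrow> 'a vfield \<Rightarrow> 'a vfield \<Rightarrow> 'a vfield" where
  "torsion nabla X Y = nabla X Y - nabla Y X - lie_bracket X Y"

text \<open>
  The curvature operator of \<open>D\<close> with respect to a bracket \<open>br\<close> on the sections in the lower slot.
  It is used for \<open>\<nabla>\<close> on vector fields, for \<open>\<nabla>\<close> on 1-forms and for connections on \<open>TM \<oplus> T*M\<close>.
\<close>

definition curvature ::
    "('s \<Rightarrow> 's \<Rightarrow> 's) \<Rightarrow> ('s \<Rightarrow> 't \<Rightarrow> 't) \<Rightarrow> 's \<Rightarrow> 's \<Rightarrow> 't \<Rightarrow> 't::minus" where
  "curvature br D s t u = D s (D t u) - D t (D s u) - D (br s t) u"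

definition flat_connection ::
    "'s set \<Rightarrow> ('s \<Rightarrow> 's \<Rightarrow> 's) \<Rightarrow> ('s \<Rightarrow> 's \<Rightarrow> 's::{minus,zero}) \<Rightarrow> bool" where
  "flat_connection \<Gamma> br D \<longleftrightarrow> (\<forall>s\<in>\<Gamma>. \<forall>t\<in>\<Gamma>. \<forall>u\<in>\<Gamma>. curvature br D s t u = 0)"

definition quasi_statistical_manifold ::
    "('a::{t2_space, second_countable_topology}, 'n::finite) chart set \<Rightarrow> 'a tensor02 \<Rightarrow>
       ('a vfield \<Rightarrow> 'a vfield \<Rightarrow> 'a vfield) \<Rightarrow> bool" where
  "quasi_statistical_manifold A h nabla \<longleftrightarrow>
     smooth_manifold A \<and> h \<in> tensor_fields02 A \<and> nondegenerate A h \<and> affine_connection A nabla \<and>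
     (\<forall>X\<in>vector_fields A. \<forall>Y\<in>vector_fields A. \<forall>Z\<in>vector_fields A.
        nabla_tensor nabla X h Y Z - nabla_tensor nabla Y h X Z
          + tensor_apply h (torsion nabla X Y) Z = 0)"

section \<open>The generalized tangent bundle\<close>

text \<open>The section \<open>X + \<alpha>\<close> of \<open>TM \<oplus> T*M\<close> is the pair \<open>(X, \<alpha>)\<close>.\<close>

type_synonym 'a gsection = "'a vfield \<times> 'a oneform"

definition gsections :: "('a, 'n::finite) chart set \<Rightarrow> 'a gsection set" where
  "gsections A = vector_fields A \<times> one_forms A"

definition gbracket ::
    "('a, 'n::finite) chart set \<Rightarrow> ('a vfield \<Rightarrow> 'a vfield \<Rightarrow> 'a vfield) \<Rightarrow>
       'a gsection \<Rightarrow> 'a gsection \<Rightarrow> 'a gsection" where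
  "gbracket A nabla = (\<lambda>(X, \<alpha>) (Y, \<beta>).
     (lie_bracket X Y, nabla_form A nabla X \<beta> - nabla_form A nabla Y \<alpha>))"

text \<open>The second case is meant for skew-symmetric \<open>h\<close>; a non-degenerate \<open>h\<close> is not both.\<close>

definition h_hat ::
    "('a, 'n::finite) chart set \<Rightarrow> 'a tensor02 \<Rightarrow> 'a gsection \<Rightarrow> 'a gsection \<Rightarrow> 'a \<Rightarrow> real" where
  "h_hat A h = (\<lambda>(X, \<alpha>) (Y, \<beta>).
     if symmetric_tensor A h
     then (\<lambda>p. - (1/2) * (form_apply \<alpha> Y p + form_apply \<beta> X p))
     else (\<lambda>p. - (1/2) * (form_apply \<alpha> Y p - form_apply \<beta> X p)))"

definition nabla_hat ::
    "('a, 'n::finite) chart set \<Rightarrow> 'a tensor02 \<Rightarrow> ('a vfield \<Rightarrow> 'a vfield \<Rightarrow> 'a vfield) \<Rightarrow>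
       'a gsection \<Rightarrow> 'a gsection \<Rightarrow> 'a gsection" where
  "nabla_hat A h nabla = (\<lambda>(X, \<alpha>) (Y, \<beta>). (nabla X Y, flat h (nabla X (sharp A h \<beta>))))"

definition dual_connection ::
    "('a, 'n::finite) chart set \<Rightarrow> ('a gsection \<Rightarrow> 'a gsection \<Rightarrow> 'a \<Rightarrow> real) \<Rightarrow>
       ('a gsection \<Rightarrow> 'a gsection \<Rightarrow> 'a gsection) \<Rightarrow>
       'a gsection \<Rightarrow> 'a gsection \<Rightarrow> 'a gsection" where
  "dual_connection A H D \<sigma> \<nu> = (THE \<rho>. \<rho> \<in> gsections A \<and>
     (\<forall>\<tau>\<in>gsections A. H \<tau> \<rho> = vf_apply (fst \<sigma>) (H \<tau> \<nu>) - H (D \<sigma> \<tau>) \<nu>))"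

end

theory Submission
  imports Defs
begin

text \<open>
  For \<open>h\<close> symmetric or skew-symmetric, the defining equation of the dual connection is solved by
  \<open>\<nabla>\<^sup>*(Z + \<gamma>) = h\<^sup>-\<^sup>1(\<nabla>\<^sub>X h(Z)) + \<nabla>\<^sub>X \<gamma>\<close>, so both connections are \<open>\<nabla>\<close> on one summand and its conjugate by
  \<open>h\<close> on the other, and the curvature formulas follow because conjugation commutes with curvature.
  Flatness on 1-forms comes from \<open>(R(X,Y)\<gamma>)(Z) = - \<gamma>(R(X,Y)Z)\<close>.  The work lies in showing that the
  objects exist: \<open>\<nabla>\<^sub>X \<gamma>\<close> is a 1-form because a function-linear map on vector fields is pointwise, and
  \<open>h\<^sup>-\<^sup>1(\<gamma>)\<close> is a smooth vector field by Cramer's rule.  Both rest on a global frame near a point,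
  obtained from bump functions and Hadamard's lemma.
\<close>

section \<open>Functions of class \<open>C\<^sup>k\<close>\<close>

text \<open>\<open>nabla_form\<close> and \<open>dual_connection\<close> are definite descriptions,
  so nothing can be computed with them before existence and uniqueness are known; this is why
  analysis outweighs curvature algebra here. Tangent vectors act only on globally smooth functions,
  so coordinates and partial derivatives become available only after multiplication by a bump
  function. The resulting weights stay in the identities, which then hold on the whole manifold, and
  are cancelled only where they are nonzero. On the algebraic side, both connections see the lower
  slot only through its vector field, and the vector part of \<open>gbracket\<close> is the Lie
  bracket. The symmetry of \<open>h\<close> enters where arguments of \<open>h\<close> must be
  exchanged, namely in computing the dual connection.\<close>

lemma Ck_on_SucD:
  "Ck_on (Suc k) S f \<Longrightarrow> x \<in> S \<Longrightarrow> (f has_derivative frechet_derivative f (at x)) (at x)"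
  by (simp add: frechet_derivative_works)

text \<open>On an open set the derivative at a point depends only on values inside the set, so
  agreement of the functions passes to their derivatives and the induction continues.\<close>

lemma Ck_on_cong:
  assumes "open S" "\<And>x. x \<in> S \<Longrightarrow> f x = g x" "Ck_on k S f"
  shows "Ck_on k S g"
  using assms(2,3)
proof (induction k arbitrary: f g)
  case 0
  then show ?case by (simp cong: continuous_on_cong)
next
  case (Suc k)
  have d: "(g has_derivative frechet_derivative f (at x)) (at x)" if "x \<in> S" for x
    using has_derivative_transform_within_open[OF Ck_on_SucD[OF Suc.prems(2) that] assms(1) that]
      Suc.prems(1) by blast
  have "frechet_derivative f (at x) v = frechet_derivative g (at x) v" if "x \<in> S" for x v
    using frechet_derivative_at[OF d[OF that]] by simp
  then show ?case
    using Suc.IH[of "\<lambda>x. frechet_derivative f (at x) v" "\<lambda>x. frechet_derivative g (at x) v" for v]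
      Suc.prems d by (simp add: differentiable_def) blast
qed

text \<open>Uniqueness of the derivative lets any explicitly known \<open>f'\<close> replace
  \<open>frechet_derivative\<close>; the closure rules below are all proved in this way.\<close>

lemma Ck_on_SucI:
  assumes "open S" "\<And>x. x \<in> S \<Longrightarrow> (f has_derivative f' x) (at x)"
    and "\<And>v. Ck_on k S (\<lambda>x. f' x v)"
  shows "Ck_on (Suc k) S f"
proof -
  have "f' x v = frechet_derivative f (at x) v" if "x \<in> S" for x v
    using frechet_derivative_at[OF assms(2)[OF that]] by simp
  then have "Ck_on k S (\<lambda>x. frechet_derivative f (at x) v)" for v
    by (intro Ck_on_cong[OF assms(1) _ assms(3)])
  then show ?thesis using assms(2) by (auto simp: differentiable_def)
qed

lemma Ck_on_local:
  assumes "\<And>x. x \<in> S \<Longrightarrow> \<exists>T. open T \<and> x \<in> T \<and> Ck_on k T f"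
  shows "Ck_on k S f"
  using assms
proof (induction k arbitrary: f)
  case 0
  show ?case
    unfolding Ck_on.simps
  proof (rule continuous_at_imp_continuous_on, rule ballI)
    fix x assume "x \<in> S"
    with 0 obtain T where "open T" "x \<in> T" "continuous_on T f" by auto
    then show "isCont f x" by (simp add: continuous_on_eq_continuous_at)
  qed
next
  case (Suc k)
  then show ?case by (fastforce intro!: Suc.IH)
qed

lemma Ck_on_subset: "Ck_on k T f \<Longrightarrow> S \<subseteq> T \<Longrightarrow> Ck_on k S f"
  by (induction k arbitrary: f) (auto intro: continuous_on_subset)

lemma Ck_on_SucD_le: "Ck_on (Suc k) S f \<Longrightarrow> Ck_on k S f"
proof (induction k arbitrary: f)
  case 0
  then show ?case
    by (auto intro!: continuous_at_imp_continuous_on differentiable_imp_continuous_within)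
next
  case (Suc k)
  show ?case
    unfolding Ck_on.simps(2)[of k]
  proof (intro conjI allI)
    show "\<forall>x\<in>S. f differentiable at x" using Suc.prems by simp
    show "Ck_on k S (\<lambda>x. frechet_derivative f (at x) v)" for v
      using Suc.prems by (intro Suc.IH) (simp only: Ck_on.simps(2)[of "Suc k"])
  qed
qed

lemma Ck_on_imp_continuous_on: "Ck_on k S f \<Longrightarrow> continuous_on S f"
  using Ck_on_SucD_le by (induction k) auto

lemma Ck_on_const: "open S \<Longrightarrow> Ck_on k S (\<lambda>x. c)"
proof (induction k arbitrary: c)
  case (Suc k)
  show ?case
    by (rule Ck_on_SucI[OF Suc.prems has_derivative_const]) (use Suc in simp)
qed simp

lemma Ck_on_bounded_linear:
  assumes "open S" "bounded_linear L" "Ck_on k S f"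
  shows "Ck_on k S (\<lambda>x. L (f x))"
  using assms(3)
proof (induction k arbitrary: f)
  case 0
  then show ?case using bounded_linear.continuous_on[OF assms(2)] by auto
next
  case (Suc k)
  show ?case
    by (rule Ck_on_SucI[OF assms(1) bounded_linear.has_derivative[OF assms(2)
            Ck_on_SucD[OF Suc.prems]]])
      (use Suc in auto)
qed

lemma Ck_on_ident: "open S \<Longrightarrow> Ck_on k S (\<lambda>x. x)"
proof (cases k)
  case (Suc j)
  assume "open S"
  then show ?thesis
    unfolding Suc using Ck_on_const by (intro Ck_on_SucI[OF _ has_derivative_ident]) auto
qed (auto intro: continuous_on_id)

lemma Ck_on_add:
  assumes "open S" "Ck_on k S f" "Ck_on k S g"
  shows "Ck_on k S (\<lambda>x. f x + g x)"
  using assms(2,3)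
proof (induction k arbitrary: f g)
  case 0
  then show ?case by (auto intro: continuous_on_add)
next
  case (Suc k)
  show ?case
    by (rule Ck_on_SucI[OF assms(1) has_derivative_add[OF Ck_on_SucD[OF Suc.prems(1)]
            Ck_on_SucD[OF Suc.prems(2)]]])
      (use Suc in auto)
qed

lemma Ck_on_sum:
  assumes "open S" "\<And>i. i \<in> I \<Longrightarrow> Ck_on k S (f i)"
  shows "Ck_on k S (\<lambda>x. \<Sum>i\<in>I. f i x)"
  using assms(2)
  by (induction I rule: infinite_finite_induct)
    (auto intro: Ck_on_add Ck_on_const assms(1))

text \<open>The product rule mixes the functions with their derivatives, so the induction also needs
  the functions themselves one order lower. The bilinear form covers products, scalar multiples and
  inner products at once.\<close>

lemma (in bounded_bilinear) Ck_on:
  assumes "open S" "Ck_on k S f" "Ck_on k S g"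
  shows "Ck_on k S (\<lambda>x. prod (f x) (g x))"
  using assms(2,3)
proof (induction k arbitrary: f g)
  case 0
  then show ?case by (auto intro: continuous_on)
next
  case (Suc k)
  show ?case
  proof (rule Ck_on_SucI[OF assms(1) FDERIV[OF Ck_on_SucD[OF Suc.prems(1)]
            Ck_on_SucD[OF Suc.prems(2)]]])
    show "Ck_on k S (\<lambda>x. prod (f x) (frechet_derivative g (at x) v)
        + prod (frechet_derivative f (at x) v) (g x))" for v
      using Suc.prems
      by (intro Ck_on_add assms(1) Suc.IH Ck_on_SucD_le[OF Suc.prems(1)]
          Ck_on_SucD_le[OF Suc.prems(2)]) auto
  qed
qed

lemmas Ck_on_mult = bounded_bilinear.Ck_on[OF bounded_bilinear_mult]

lemma Ck_on_inverse:
  fixes f :: "'e::real_normed_vector \<Rightarrow> real"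
  assumes "open S" "\<And>x. x \<in> S \<Longrightarrow> f x \<noteq> 0" "Ck_on k S f"
  shows "Ck_on k S (\<lambda>x. inverse (f x))"
  using assms(3)
proof (induction k)
  case 0
  then show ?case using assms(2) by (auto intro: continuous_on_inverse)
next
  case (Suc k)
  show ?case
  proof (rule Ck_on_SucI[OF assms(1) Deriv.has_derivative_inverse[OF assms(2) Ck_on_SucD[OF Suc.prems]]])
    show "Ck_on k S (\<lambda>x. - (inverse (f x) * frechet_derivative f (at x) v * inverse (f x)))" for v
      using Suc.prems
      by (intro Ck_on_mult Ck_on_bounded_linear[OF assms(1) bounded_linear_minus[OF bounded_linear_ident]]
          assms(1) Suc.IH Ck_on_SucD_le[OF Suc.prems]) auto
  qed
qed

text \<open>The chain rule differentiates \<open>f\<close> in a direction that varies with the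
  point, whereas \<open>Ck_on\<close> speaks of fixed directions only. Expanding the direction in
  the finite basis of the middle space separates the two dependences.\<close>

lemma Ck_on_compose:
  fixes f :: "'b::euclidean_space \<Rightarrow> 'c::real_normed_vector"
    and g :: "'a::real_normed_vector \<Rightarrow> 'b"
  assumes "open S" "g ` S \<subseteq> T" "Ck_on k T f" "Ck_on k S g"
  shows "Ck_on k S (\<lambda>x. f (g x))"
  using assms(3,4)
proof (induction k arbitrary: f)
  case 0
  then show ?case using assms(2) by (auto intro: continuous_on_compose2)
next
  case (Suc k)
  have T: "g x \<in> T" if "x \<in> S" for x using that assms(2) by auto
  have d: "((\<lambda>x. f (g x)) has_derivative
      (\<lambda>v. frechet_derivative f (at (g x)) (frechet_derivative g (at x) v))) (at x)" if "x \<in> S" for x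
    using has_derivative_compose[OF Ck_on_SucD[OF Suc.prems(2) that] Ck_on_SucD[OF Suc.prems(1) T[OF that]]]
    by simp
  have e: "frechet_derivative f (at (g x)) w
      = (\<Sum>i\<in>Basis. (w \<bullet> i) *\<^sub>R frechet_derivative f (at (g x)) i)" if "x \<in> S" for x w
  proof -
    have "linear (frechet_derivative f (at (g x)))"
      using Suc.prems(1) T[OF that] by (simp add: linear_frechet_derivative)
    then have "frechet_derivative f (at (g x)) (\<Sum>i\<in>Basis. (w \<bullet> i) *\<^sub>R i)
        = (\<Sum>i\<in>Basis. (w \<bullet> i) *\<^sub>R frechet_derivative f (at (g x)) i)"
      by (simp add: linear_sum linear_scale)
    then show ?thesis by (simp add: euclidean_representation)
  qed
  show ?case
  proof (rule Ck_on_SucI[OF assms(1) d])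
    fix v
    have "Ck_on k S (\<lambda>x. \<Sum>i\<in>Basis. (frechet_derivative g (at x) v \<bullet> i) *\<^sub>R
        frechet_derivative f (at (g x)) i)"
      using Suc.prems
      by (intro Ck_on_sum assms(1) bounded_bilinear.Ck_on[OF bounded_bilinear_scaleR]
          Ck_on_bounded_linear[OF assms(1) bounded_linear_inner_left]
          Suc.IH[OF _ Ck_on_SucD_le[OF Suc.prems(2)]]) auto
    then show "Ck_on k S (\<lambda>x. frechet_derivative f (at (g x)) (frechet_derivative g (at x) v))"
      by (rule Ck_on_cong[OF assms(1), rotated]) (simp add: e[symmetric])
  qed
qed

section \<open>Bump functions and Hadamard's lemma\<close>

text \<open>For \<open>m = 0\<close> this is the classical smooth function that is flat at 0. The
  powers of \<open>1 / t\<close> are included because they appear on differentiation, so the span of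
  the family is closed under derivatives.\<close>

definition flat_exp :: "nat \<Rightarrow> real \<Rightarrow> real" where
  "flat_exp m t = (if t > 0 then (1 / t) ^ m * exp (- (1 / t)) else 0)"

lemma flat_exp_bound: "\<bar>flat_exp m t\<bar> \<le> fact (m + 2) * t\<^sup>2"
proof (cases "t > 0")
  case True
  define s where "s = 1 / t"
  have s: "s > 0" "t = 1 / s" using True by (auto simp: s_def)
  \<comment> \<open>A single term of the exponential series, with nonnegative terms, bounds
    \<open>exp s\<close> from below. The index \<open>m + 2\<close> leaves a factor
    \<open>t\<^sup>2\<close> after cancelling \<open>s ^ m\<close>, one power more than the
    difference quotient at 0 consumes.\<close>
  have "(\<Sum>i\<in>{m+2}. s ^ i /\<^sub>R fact i) \<le> exp s"
    unfolding exp_def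
    by (rule sum_le_suminf[OF summable_exp_generic]) (use s in auto)
  then have "s ^ (m + 2) \<le> fact (m + 2) * exp s" by (simp add: field_simps del: fact_Suc power_Suc)
  then have "s ^ (m + 2) * exp (- s) * t\<^sup>2 \<le> fact (m + 2) * exp s * exp (- s) * t\<^sup>2"
    by (intro mult_right_mono) auto
  moreover have "s ^ (m + 2) * t\<^sup>2 = s ^ m"
    using s by (simp add: power_divide power2_eq_square)
  moreover have "exp s * exp (- s) = 1" by (simp flip: exp_add)
  ultimately have "s ^ m * exp (- s) \<le> fact (m + 2) * t\<^sup>2"
    by (metis (no_types, lifting) mult.assoc mult.commute mult.right_neutral)
  then show ?thesis using True s by (simp add: flat_exp_def del: fact_Suc)
qed (simp add: flat_exp_def)

lemma DERIV_flat_exp: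
  "(flat_exp m has_real_derivative flat_exp (m + 2) t - m * flat_exp (m + 1) t) (at t)"
proof -
  consider "t > 0" | "t < 0" | "t = 0" by linarith
  then show ?thesis
  proof cases
    case 1
    \<comment> \<open>For \<open>m = 0\<close> the exponent \<open>m - 1\<close> is truncated to 0,
      which is harmless because its coefficient vanishes.\<close>
    have "((\<lambda>s. s ^ m * exp (- s)) has_real_derivative
        m * s ^ (m - 1) * exp (- s) - s ^ m * exp (- s)) (at s)" for s :: real
      by (auto intro!: derivative_eq_intros simp: algebra_simps)
    moreover have "((\<lambda>t. 1 / t) has_real_derivative - ((1 / t) ^ 2)) (at t)"
      using 1 by (auto intro!: derivative_eq_intros simp: power2_eq_square)
    ultimately have "((\<lambda>t. (1 / t) ^ m * exp (- (1 / t))) has_real_derivative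
        (m * (1 / t) ^ (m - 1) * exp (- (1 / t)) - (1 / t) ^ m * exp (- (1 / t))) * - ((1 / t) ^ 2)) (at t)"
      by (rule DERIV_chain2)
    also have "(m * (1 / t) ^ (m - 1) * exp (- (1 / t)) - (1 / t) ^ m * exp (- (1 / t))) * - ((1 / t) ^ 2)
        = flat_exp (m + 2) t - m * flat_exp (m + 1) t"
      using 1 by (cases m) (simp_all add: flat_exp_def algebra_simps power2_eq_square add_divide_distrib)
    finally have "((\<lambda>t. (1 / t) ^ m * exp (- (1 / t))) has_real_derivative
        flat_exp (m + 2) t - m * flat_exp (m + 1) t) (at t)" .
    then show ?thesis
      by (rule DERIV_cong_ev[THEN iffD1, rotated 3])
        (use 1 eventually_nhds_in_open[of "{0<..}" t] in \<open>auto simp: flat_exp_def elim!: eventually_mono\<close>)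
  next
    case 2
    have "((\<lambda>t. 0) has_real_derivative flat_exp (m + 2) t - m * flat_exp (m + 1) t) (at t)"
      using 2 by (simp add: flat_exp_def)
    then show ?thesis
      by (rule DERIV_cong_ev[THEN iffD1, rotated 3])
        (use 2 eventually_nhds_in_open[of "{..<0}" t] in \<open>auto simp: flat_exp_def elim!: eventually_mono\<close>)
  next
    case 3
    have "((\<lambda>y. flat_exp m y / y) \<longlongrightarrow> 0) (at 0)"
    proof (rule Lim_null_comparison)
      show "\<forall>\<^sub>F y in at 0. norm (flat_exp m y / y) \<le> fact (m + 2) * \<bar>y\<bar>"
      proof (rule always_eventually, rule allI)
        fix y :: real
        show "norm (flat_exp m y / y) \<le> fact (m + 2) * \<bar>y\<bar>"
          using flat_exp_bound[of m y]
          by (cases "y = 0") (auto simp: field_simps power2_eq_square abs_mult_self_eq simp del: fact_Suc)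
      qed
      show "((\<lambda>y. fact (m + 2) * \<bar>y\<bar>) \<longlongrightarrow> (0::real)) (at 0)"
        by (auto intro!: tendsto_eq_intros)
    qed
    then show ?thesis
      unfolding 3 has_field_derivative_iff by (simp add: flat_exp_def)
  qed
qed

text \<open>The induction on \<open>k\<close> must treat all \<open>m\<close> together, since the
  derivative of one member involves the members \<open>m + 1\<close> and
  \<open>m + 2\<close>.\<close>

lemma Ck_on_flat_exp: "Ck_on k UNIV (flat_exp m)"
proof (induction k arbitrary: m)
  case 0
  then show ?case
    by (auto intro!: continuous_at_imp_continuous_on DERIV_isCont[OF DERIV_flat_exp])
next
  case (Suc k)
  show ?case
  proof (rule Ck_on_SucI[OF open_UNIV DERIV_flat_exp[unfolded has_field_derivative_def]])
    fix v :: real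
    have "Ck_on k UNIV (\<lambda>x. flat_exp (m + 2) x * v + flat_exp (m + 1) x * (- (m * v)))"
      by (intro Ck_on_add Ck_on_mult Ck_on_const Suc.IH open_UNIV)
    then show "Ck_on k UNIV (\<lambda>x. (flat_exp (m + 2) x - m * flat_exp (m + 1) x) * v)"
      by (simp add: algebra_simps)
  qed
qed

text \<open>The squared distance is used because it is smooth at the centre, unlike the norm. The
  function is positive exactly on the ball but has no plateau of value 1, which is why later
  formulas carry powers of it as weights.\<close>

definition bump :: "'b::euclidean_space \<Rightarrow> real \<Rightarrow> 'b \<Rightarrow> real" where
  "bump y r x = flat_exp 0 (r\<^sup>2 - (x - y) \<bullet> (x - y))"

lemma bump_pos_iff: "r > 0 \<Longrightarrow> bump y r x > 0 \<longleftrightarrow> x \<in> ball y r"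
  and bump_zero: "r > 0 \<Longrightarrow> x \<notin> ball y r \<Longrightarrow> bump y r x = 0"
proof -
  assume r: "r > 0"
  have "(x - y) \<bullet> (x - y) < r\<^sup>2 \<longleftrightarrow> x \<in> ball y r"
    using r by (metis abs_of_pos dist_commute dist_norm mem_ball power2_norm_eq_inner
        real_sqrt_abs real_sqrt_less_iff norm_ge_zero abs_of_nonneg)
  then show "bump y r x > 0 \<longleftrightarrow> x \<in> ball y r" "x \<notin> ball y r \<Longrightarrow> bump y r x = 0"
    by (auto simp: bump_def flat_exp_def)
qed

lemma Ck_on_bump: "Ck_on k UNIV (bump (y::'b::euclidean_space) r)"
proof -
  have a: "Ck_on k UNIV (\<lambda>x::'b. x - y)"
    using Ck_on_add[OF open_UNIV Ck_on_ident[OF open_UNIV] Ck_on_const[OF open_UNIV, of k "- y"]] by simp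
  have "Ck_on k UNIV (\<lambda>x. r\<^sup>2 + - ((x - y) \<bullet> (x - y)))"
    by (intro Ck_on_add open_UNIV Ck_on_const a bounded_bilinear.Ck_on[OF bounded_bilinear_inner]
        Ck_on_bounded_linear[OF open_UNIV bounded_linear_minus[OF bounded_linear_ident]])
  then have "Ck_on k UNIV (\<lambda>x. r\<^sup>2 - (x - y) \<bullet> (x - y))" by simp
  from Ck_on_compose[OF open_UNIV _ Ck_on_flat_exp this] show ?thesis
    unfolding bump_def[abs_def] by blast
qed

section \<open>Integrals along segments and Hadamard's lemma\<close>

lemma segment_in_ball:
  fixes y :: "'b::real_normed_vector"
  assumes "x \<in> ball y r" "t \<in> {0..1}"
  shows "y + t *\<^sub>R (x - y) \<in> ball y r"
proof -
  have "\<bar>t\<bar> * norm (x - y) \<le> 1 * norm (x - y)"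
    using assms by (intro mult_right_mono) auto
  then show ?thesis using assms by (simp add: dist_norm norm_minus_commute)
qed

lemma continuous_on_segment:
  fixes G :: "'b::euclidean_space \<Rightarrow> real"
  assumes "continuous_on (ball y r) G"
  shows "continuous_on (ball y r \<times> {0..1}) (\<lambda>(x, t). t ^ j * G (y + t *\<^sub>R (x - y)))"
    and "x \<in> ball y r \<Longrightarrow> continuous_on {0..1} (\<lambda>t. t ^ j * G (y + t *\<^sub>R (x - y)))"
proof -
  have c: "continuous_on (ball y r \<times> {0..1}) (\<lambda>z. (snd z) ^ j * G (y + snd z *\<^sub>R (fst z - y)))"
    by (intro continuous_intros continuous_on_compose2[OF assms])
      (use segment_in_ball[of _ y r] in \<open>auto simp del: mem_ball\<close>)
  then show "continuous_on (ball y r \<times> {0..1}) (\<lambda>(x, t). t ^ j * G (y + t *\<^sub>R (x - y)))"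
    by (simp add: case_prod_unfold)
  show "continuous_on {0..1} (\<lambda>t. t ^ j * G (y + t *\<^sub>R (x - y)))" if "x \<in> ball y r"
    by (intro continuous_intros continuous_on_compose2[OF assms])
      (use segment_in_ball[of _ y r] that in \<open>auto simp del: mem_ball\<close>)
qed

text \<open>Differentiating under the integral produces a factor \<open>t\<close> from the chain
  rule. The weight \<open>t ^ j\<close> with arbitrary \<open>j\<close> absorbs it, so the
  derivative is again an integral of the same shape.\<close>

lemma Ck_on_integral_segment:
  fixes G :: "'b::euclidean_space \<Rightarrow> real"
  assumes "Ck_on k (ball y r) G"
  shows "Ck_on k (ball y r) (\<lambda>x. integral {0..1} (\<lambda>t. t ^ j * G (y + t *\<^sub>R (x - y))))"
  using assms
proof (induction k arbitrary: G j)
  case 0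
  then show ?case
    using integral_continuous_on_param[of "ball y r" 0 "1::real" "\<lambda>x t. t ^ j * G (y + t *\<^sub>R (x - y))"]
      continuous_on_segment(1)[of y r G j] by simp
next
  case (Suc k)
  let ?D = "\<lambda>z. frechet_derivative G (at z)"
  \<comment> \<open>The Leibniz rule for parameter integrals expects the derivative as a continuous
    map into bounded linear functions. The value of \<open>Blinfun\<close> is meaningful for
    \<open>x\<close> in the ball and \<open>t\<close> in the unit interval, the only arguments that
    occur.\<close>
  define fx where "fx x t = Blinfun (\<lambda>v. t ^ Suc j * ?D (y + t *\<^sub>R (x - y)) v)" for x t
  have bl: "bounded_linear (?D z)" if "z \<in> ball y r" for z
    using Ck_on_SucD[OF Suc.prems that] by (rule has_derivative_bounded_linear)
  have fx: "blinfun_apply (fx x t) = (\<lambda>v. t ^ Suc j * ?D (y + t *\<^sub>R (x - y)) v)"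
    if "x \<in> ball y r" "t \<in> {0..1}" for x t
    unfolding fx_def
    by (rule bounded_linear_Blinfun_apply, rule bounded_linear_const_mult,
        rule bl[OF segment_in_ball[OF that]])
  have cont: "continuous_on (ball y r) (\<lambda>z. ?D z v)" for v
    using Suc.prems by (auto intro: Ck_on_imp_continuous_on)
  have G: "continuous_on (ball y r) G"
    using Suc.prems by (rule Ck_on_imp_continuous_on)
  have cfx: "continuous_on (ball y r \<times> cbox 0 1) (\<lambda>(x, t). fx x t)"
  proof (rule continuous_on_blinfun_componentwise)
    fix i :: 'b
    show "continuous_on (ball y r \<times> cbox 0 1) (\<lambda>z. blinfun_apply (case z of (x, t) \<Rightarrow> fx x t) i)"
      unfolding box_real
      by (rule continuous_on_eq[OF continuous_on_segment(1)[OF cont[of i], of "Suc j"]])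
        (auto simp: fx)
  qed
  have d: "((\<lambda>x. integral (cbox 0 1) (\<lambda>t. t ^ j * G (y + t *\<^sub>R (x - y)))) has_derivative
       blinfun_apply (integral (cbox 0 1) (fx x))) (at x)" if x: "x \<in> ball y r" for x
  proof -
    have "((\<lambda>x. integral (cbox 0 1) (\<lambda>t. t ^ j * G (y + t *\<^sub>R (x - y)))) has_derivative
       blinfun_apply (integral (cbox 0 1) (fx x))) (at x within ball y r)"
    proof (rule leibniz_rule[OF _ _ cfx x convex_ball])
      fix x t assume *: "x \<in> ball y r" "t \<in> cbox 0 (1::real)"
      then have "((\<lambda>x. G (y + t *\<^sub>R (x - y))) has_derivative
          (\<lambda>v. ?D (y + t *\<^sub>R (x - y)) (t *\<^sub>R v))) (at x)"
        by (intro has_derivative_compose[OF _ Ck_on_SucD[OF Suc.prems]])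
          (auto intro!: derivative_eq_intros segment_in_ball simp del: mem_ball)
      then have "((\<lambda>x. t ^ j * G (y + t *\<^sub>R (x - y))) has_derivative
          (\<lambda>v. t ^ j * ?D (y + t *\<^sub>R (x - y)) (t *\<^sub>R v))) (at x)"
        by (rule has_derivative_mult_right)
      moreover have "(\<lambda>v. t ^ j * ?D (y + t *\<^sub>R (x - y)) (t *\<^sub>R v)) = blinfun_apply (fx x t)"
        using fx[of x t] * bl[OF segment_in_ball, of x t, THEN bounded_linear.linear, THEN linear_scale]
        by (auto simp: mult_ac)
      ultimately show "((\<lambda>x. t ^ j * G (y + t *\<^sub>R (x - y))) has_derivative
          blinfun_apply (fx x t)) (at x within ball y r)"
        by (simp add: has_derivative_at_withinI)
    next
      fix x assume "x \<in> ball y r"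
      then show "(\<lambda>t. t ^ j * G (y + t *\<^sub>R (x - y))) integrable_on cbox 0 1"
        using continuous_on_segment(2)[OF G, of x j] by (simp add: integrable_continuous_interval)
    qed
    then show ?thesis using at_within_open[OF x open_ball] by simp
  qed
  have e: "blinfun_apply (integral (cbox 0 1) (fx x)) v
      = integral {0..1} (\<lambda>t. t ^ Suc j * ?D (y + t *\<^sub>R (x - y)) v)" if x: "x \<in> ball y r" for x v
  proof -
    have "continuous_on (cbox 0 1) (\<lambda>t. case (x, t) of (x, t) \<Rightarrow> fx x t)"
      by (rule continuous_on_compose2[OF cfx continuous_on_Pair[OF continuous_on_const continuous_on_id]])
        (use x in auto)
    then have "fx x integrable_on cbox 0 1"
      by (intro integrable_continuous) simp
    then have "blinfun_apply (integral (cbox 0 1) (fx x)) v = integral {0..1} (\<lambda>t. fx x t v)"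
      using blinfun_apply_integral by simp
    also have "\<dots> = integral {0..1} (\<lambda>t. t ^ Suc j * ?D (y + t *\<^sub>R (x - y)) v)"
      by (rule Henstock_Kurzweil_Integration.integral_cong) (simp add: fx[OF x])
    finally show ?thesis .
  qed
  have "Ck_on k (ball y r) (\<lambda>x. blinfun_apply (integral (cbox 0 1) (fx x)) v)" for v
    using Suc.IH[of "\<lambda>z. ?D z v" "Suc j"] Suc.prems
    by (intro Ck_on_cong[OF open_ball e[symmetric]]) auto
  from Ck_on_SucI[OF open_ball d this] show ?case by simp
qed

text \<open>This is the fundamental theorem of calculus along the segment from \<open>y\<close> to
  \<open>x\<close>, with \<open>x - y\<close> expanded in the basis. The factor \<open>t ^ 0\<close>
  is kept so that the coefficients are literally the integrals of
  \<open>Ck_on_integral_segment\<close> for \<open>j = 0\<close>.\<close>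

lemma hadamard:
  fixes F :: "'b::euclidean_space \<Rightarrow> real"
  assumes "Ck_on (Suc 0) (ball y r) F" "x \<in> ball y r"
  shows "F x = F y + (\<Sum>i\<in>Basis. ((x - y) \<bullet> i) *
    integral {0..1} (\<lambda>t. t ^ 0 * frechet_derivative F (at (y + t *\<^sub>R (x - y))) i))"
proof -
  let ?D = "\<lambda>z. frechet_derivative F (at z)"
  let ?g = "\<lambda>t. y + t *\<^sub>R (x - y)"
  have D: "(F has_derivative ?D (?g t)) (at (?g t))" if "t \<in> {0..1}" for t
    using Ck_on_SucD[OF assms(1) segment_in_ball[OF assms(2) that]] .
  have e: "?D (?g t) (x - y) = (\<Sum>i\<in>Basis. ((x - y) \<bullet> i) * (t ^ 0 * ?D (?g t) i))"
    if "t \<in> {0..1}" for t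
  proof -
    have l: "linear (?D (?g t))" using D[OF that] by (rule has_derivative_linear)
    have "?D (?g t) (\<Sum>i\<in>Basis. ((x - y) \<bullet> i) *\<^sub>R i) = (\<Sum>i\<in>Basis. ((x - y) \<bullet> i) * ?D (?g t) i)"
      by (simp only: linear_sum[OF l] linear_scale[OF l] real_scaleR_def)
    then show ?thesis by (simp add: euclidean_representation)
  qed
  have "((\<lambda>t. ?D (?g t) (x - y)) has_integral F (?g 1) - F (?g 0)) {0..1}"
  proof (rule fundamental_theorem_of_calculus)
    fix t :: real assume t: "t \<in> {0..1}"
    have "((\<lambda>t. F (?g t)) has_derivative (\<lambda>s. ?D (?g t) (s *\<^sub>R (x - y)))) (at t)"
      by (rule has_derivative_compose[where f="?g" and g=F, OF _ D[OF t]]) (auto intro!: derivative_eq_intros)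
    then have "((\<lambda>t. F (?g t)) has_vector_derivative ?D (?g t) (x - y)) (at t)"
      unfolding has_vector_derivative_def
      by (rule has_derivative_eq_rhs) (use linear_scale[OF has_derivative_linear[OF D[OF t]]] in auto)
    then show "((\<lambda>t. F (?g t)) has_vector_derivative ?D (?g t) (x - y)) (at t within {0..1})"
      by (rule has_vector_derivative_at_within)
  qed simp
  then have "F x - F y = integral {0..1} (\<lambda>t. ?D (?g t) (x - y))"
    by (simp add: integral_unique)
  also have "\<dots> = integral {0..1} (\<lambda>t. \<Sum>i\<in>Basis. ((x - y) \<bullet> i) * (t ^ 0 * ?D (?g t) i))"
    by (rule Henstock_Kurzweil_Integration.integral_cong) (rule e)
  also have "\<dots> = (\<Sum>i\<in>Basis. integral {0..1} (\<lambda>t. ((x - y) \<bullet> i) * (t ^ 0 * ?D (?g t) i)))"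
    using assms(1)
    by (intro integral_sum integrable_on_mult_right finite_Basis integrable_continuous_interval
        continuous_on_segment(2)[OF _ assms(2)]) auto
  finally show ?thesis by simp
qed

section \<open>Smooth functions and tangent vectors\<close>

lemma smooth_functionsD:
  "f \<in> smooth_functions A \<Longrightarrow> (U, \<phi>) \<in> A \<Longrightarrow> Ck_on k (\<phi> ` U) (f \<circ> inv_into U \<phi>)"
  unfolding smooth_functions_def smooth_on_def by blast

lemma smooth_functionsI:
  "(\<And>U \<phi> k. (U, \<phi>) \<in> A \<Longrightarrow> Ck_on k (\<phi> ` U) (f \<circ> inv_into U \<phi>)) \<Longrightarrow> f \<in> smooth_functions A"
  unfolding smooth_functions_def smooth_on_def by blast

lemma sum_fun_apply: "(\<Sum>i\<in>I. f i) x = (\<Sum>i\<in>I. f i x)"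
  by (induction I rule: infinite_finite_induct) (auto simp: zero_fun_def plus_fun_def)

lemma sum_Basis_vec:
  fixes g :: "real^'n::finite \<Rightarrow> 'b::comm_monoid_add"
  shows "(\<Sum>i\<in>Basis. g i) = (\<Sum>i\<in>UNIV. g (axis i 1))"
proof -
  have B: "(Basis :: (real^'n) set) = range (\<lambda>i. axis i 1)" by (auto simp: Basis_vec_def)
  have "inj (\<lambda>i::'n. axis i (1::real))" by (auto simp: inj_def axis_eq_axis)
  from sum.reindex[OF this, of g] show ?thesis unfolding B comp_def .
qed

locale manifold =
  fixes A :: "('a::{t2_space, second_countable_topology}, 'n::finite) chart set"
  assumes manifold: "smooth_manifold A"
begin

abbreviation "C \<equiv> smooth_functions A"
abbreviation "T \<equiv> tangent_space A"
abbreviation "VF \<equiv> vector_fields A"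
abbreviation "\<Omega> \<equiv> one_forms A"

lemma chart_homeomorphism:
  "(U, \<phi>) \<in> A \<Longrightarrow> homeomorphism U (\<phi> ` U) \<phi> (inv_into U \<phi>)"
  and open_chart: "(U, \<phi>) \<in> A \<Longrightarrow> open U"
  and open_chart_image: "(U, \<phi>) \<in> A \<Longrightarrow> open (\<phi> ` U)"
  using manifold unfolding smooth_manifold_def is_chart_def by blast+

lemma chart_inv: "(U, \<phi>) \<in> A \<Longrightarrow> p \<in> U \<Longrightarrow> inv_into U \<phi> (\<phi> p) = p"
  using homeomorphism_apply1[OF chart_homeomorphism] .

lemma transition: "(U, \<phi>) \<in> A \<Longrightarrow> (V, \<psi>) \<in> A \<Longrightarrow> Ck_on k (\<phi> ` (U \<inter> V)) (\<psi> \<circ> inv_into U \<phi>)"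
  using manifold unfolding smooth_manifold_def smooth_on_def by blast

lemma obtain_chart: obtains U \<phi> where "(U, \<phi>) \<in> A" "p \<in> U"
proof -
  have "p \<in> (\<Union>(U, \<phi>)\<in>A. U)" using manifold unfolding smooth_manifold_def by simp
  then show ?thesis using that by auto
qed

lemma open_chart_image_Int: "(U, \<phi>) \<in> A \<Longrightarrow> open W \<Longrightarrow> open (\<phi> ` (U \<inter> W))"
  using homeomorphism_imp_open_map[OF chart_homeomorphism, of U \<phi> "U \<inter> W"] open_chart_image[of U \<phi>]
  by (simp add: openin_open_Int openin_open_eq)

lemma smooth_functions_localI:
  assumes "\<And>V \<psi> q k. (V, \<psi>) \<in> A \<Longrightarrow> q \<in> V \<Longrightarrow>
    \<exists>W. open W \<and> q \<in> W \<and> Ck_on k (\<psi> ` (V \<inter> W)) (f \<circ> inv_into V \<psi>)"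
  shows "f \<in> C"
proof (rule smooth_functionsI, rule Ck_on_local)
  fix V \<psi> k y assume V: "(V, \<psi>) \<in> A" and "y \<in> \<psi> ` V"
  then obtain q where q: "q \<in> V" "y = \<psi> q" by blast
  from assms[OF V q(1), of k] obtain W
    where "open W" "q \<in> W" "Ck_on k (\<psi> ` (V \<inter> W)) (f \<circ> inv_into V \<psi>)" by blast
  then show "\<exists>T. open T \<and> y \<in> T \<and> Ck_on k T (f \<circ> inv_into V \<psi>)"
    using open_chart_image_Int[OF V] q by blast
qed

lemma smooth_const [intro]: "(\<lambda>p. c) \<in> C"
  by (rule smooth_functionsI) (auto simp: comp_def intro: Ck_on_const open_chart_image)

lemma smooth_add [intro]: "f \<in> C \<Longrightarrow> g \<in> C \<Longrightarrow> (\<lambda>p. f p + g p) \<in> C"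
  using smooth_functionsD[of f A] smooth_functionsD[of g A]
  by (intro smooth_functionsI) (auto simp: comp_def intro: Ck_on_add open_chart_image)

lemma smooth_mult [intro]: "f \<in> C \<Longrightarrow> g \<in> C \<Longrightarrow> (\<lambda>p. f p * g p) \<in> C"
  using smooth_functionsD[of f A] smooth_functionsD[of g A]
  by (intro smooth_functionsI) (auto simp: comp_def intro: Ck_on_mult open_chart_image)

lemma smooth_uminus [intro]: "f \<in> C \<Longrightarrow> (\<lambda>p. - f p) \<in> C"
  using smooth_mult[OF smooth_const[of "-1"], of f] by simp

lemma smooth_diff [intro]: "f \<in> C \<Longrightarrow> g \<in> C \<Longrightarrow> (\<lambda>p. f p - g p) \<in> C"
  using smooth_add[OF _ smooth_uminus, of f g] by simp

lemma smooth_sum [intro]: "(\<And>i. i \<in> I \<Longrightarrow> f i \<in> C) \<Longrightarrow> (\<lambda>p. \<Sum>i\<in>I. f i p) \<in> C"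
  by (induction I rule: infinite_finite_induct) auto

lemma smooth_prod [intro]: "(\<And>i. i \<in> I \<Longrightarrow> f i \<in> C) \<Longrightarrow> (\<lambda>p. \<Prod>i\<in>I. f i p) \<in> C"
  by (induction I rule: infinite_finite_induct) auto

lemma smooth_continuous:
  assumes "f \<in> C"
  shows "continuous_on UNIV f"
proof (rule continuous_at_imp_continuous_on, rule ballI)
  fix p
  obtain U \<phi> where U: "(U, \<phi>) \<in> A" "p \<in> U" by (rule obtain_chart)
  have "continuous_on U (\<lambda>q. (f \<circ> inv_into U \<phi>) (\<phi> q))"
    by (rule continuous_on_compose2[OF Ck_on_imp_continuous_on[OF smooth_functionsD[OF assms U(1), of 0]]
          homeomorphism_cont1[OF chart_homeomorphism[OF U(1)]]]) simp
  then have "continuous_on U f" by (rule continuous_on_eq) (simp add: chart_inv[OF U(1)])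
  then show "isCont f p" using U open_chart[OF U(1)] by (simp add: continuous_on_eq_continuous_at)
qed

text \<open>A substitute for local division: only global smooth \<open>d\<close> and
  \<open>g\<close> are mentioned, and \<open>f\<close> equals \<open>g / d\<close> on the set where
  \<open>d\<close> is nonzero, which is open by continuity.\<close>

lemma smooth_quotient:
  assumes "\<And>p. \<exists>d\<in>C. \<exists>g\<in>C. d p \<noteq> 0 \<and> (\<forall>q. d q \<noteq> 0 \<longrightarrow> d q * f q = g q)"
  shows "f \<in> C"
proof (rule smooth_functions_localI)
  fix V \<psi> p k assume V: "(V, \<psi>) \<in> A" "p \<in> V"
  from assms[of p] obtain d g where d: "d \<in> C" "g \<in> C" "d p \<noteq> 0"
    "\<And>q. d q \<noteq> 0 \<Longrightarrow> d q * f q = g q" by blast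
  define W where "W = {q. d q \<noteq> 0}"
  have W: "open W" unfolding W_def using smooth_continuous[OF d(1)]
    by (intro open_Collect_neq) (auto intro: continuous_on_const)
  note o = open_chart_image_Int[OF V(1) W]
  have inv: "inv_into V \<psi> x \<in> W" if "x \<in> \<psi> ` (V \<inter> W)" for x
    using that chart_inv[OF V(1)] by auto
  have "Ck_on k (\<psi> ` (V \<inter> W)) (\<lambda>x. (g \<circ> inv_into V \<psi>) x * inverse ((d \<circ> inv_into V \<psi>) x))"
    using inv by (intro Ck_on_mult[OF o] Ck_on_inverse[OF o]
        Ck_on_subset[OF smooth_functionsD[OF d(1) V(1)]] Ck_on_subset[OF smooth_functionsD[OF d(2) V(1)]])
      (auto simp: W_def)
  then have "Ck_on k (\<psi> ` (V \<inter> W)) (f \<circ> inv_into V \<psi>)"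
  proof (rule Ck_on_cong[OF o, rotated])
    fix x assume "x \<in> \<psi> ` (V \<inter> W)"
    then have "d (inv_into V \<psi> x) \<noteq> 0" using inv by (simp add: W_def)
    then show "(g \<circ> inv_into V \<psi>) x * inverse ((d \<circ> inv_into V \<psi>) x) = (f \<circ> inv_into V \<psi>) x"
      using d(4)[of "inv_into V \<psi> x"] by (auto simp: field_simps)
  qed
  then show "\<exists>W. open W \<and> p \<in> W \<and> Ck_on k (\<psi> ` (V \<inter> W)) (f \<circ> inv_into V \<psi>)"
    using W d(3) unfolding W_def by blast
qed

section \<open>Extending functions given in a chart to the whole manifold\<close>

definition bump_times :: "('a, 'n) chart \<Rightarrow> real^'n \<Rightarrow> real \<Rightarrow> (real^'n \<Rightarrow> real) \<Rightarrow> 'a \<Rightarrow> real" where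
  "bump_times = (\<lambda>(U, \<phi>) y s F q. if q \<in> U then bump y s (\<phi> q) * F (\<phi> q) else 0)"

text \<open>Two open sets cover the manifold: the preimage of the larger ball, where a transition
  map carries smoothness to any other chart, and the complement of the preimage of the closed
  smaller ball, where the function is 0. The gap \<open>s < r\<close> makes them overlap
  enough.\<close>

lemma smooth_bump_times:
  assumes U: "(U, \<phi>) \<in> A" and r: "ball y r \<subseteq> \<phi> ` U" "0 < s" "s < r"
    and F: "\<And>k. Ck_on k (ball y r) F"
  shows "bump_times (U, \<phi>) y s F \<in> C"
proof (rule smooth_functions_localI)
  fix V \<psi> q k assume V: "(V, \<psi>) \<in> A" "q \<in> V"
  let ?e = "bump_times (U, \<phi>) y s F"
  define K where "K = inv_into U \<phi> ` cball y s"
  have sub: "cball y s \<subseteq> ball y r" using r by auto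
  have "continuous_on (cball y s) (inv_into U \<phi>)"
    using homeomorphism_cont2[OF chart_homeomorphism[OF U]] sub r(1)
    by (meson continuous_on_subset order_trans)
  \<comment> \<open>Compactness and the Hausdorff property make \<open>K\<close> closed in the whole
    manifold, not merely in the chart domain.\<close>
  then have K: "closed K"
    unfolding K_def by (intro compact_imp_closed compact_continuous_image) auto
  have zero: "?e x = 0" if "x \<notin> K" for x
  proof (cases "x \<in> U")
    case True
    then have "\<phi> x \<notin> cball y s" using that chart_inv[OF U True] unfolding K_def by (metis imageI)
    then show ?thesis by (auto simp: bump_times_def bump_zero[OF r(2)])
  qed (simp add: bump_times_def)
  define B where "B = U \<inter> \<phi> -` ball y r"
  have B: "open B"
    unfolding B_def
    using homeomorphism_cont1[OF chart_homeomorphism[OF U]] open_chart[OF U]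
    by (simp add: continuous_on_open_vimage Int_commute)
  show "\<exists>W. open W \<and> q \<in> W \<and> Ck_on k (\<psi> ` (V \<inter> W)) (?e \<circ> inv_into V \<psi>)"
  proof (cases "q \<in> B")
    case True
    note o = open_chart_image_Int[OF V(1) B]
    have "Ck_on k (ball y r) (\<lambda>x. bump y s x * F x)"
      by (intro Ck_on_mult F Ck_on_subset[OF Ck_on_bump]) auto
    moreover have "Ck_on k (\<psi> ` (V \<inter> B)) (\<phi> \<circ> inv_into V \<psi>)"
      by (rule Ck_on_subset[OF transition[OF V(1) U]]) (auto simp: B_def)
    moreover have "(\<phi> \<circ> inv_into V \<psi>) ` \<psi> ` (V \<inter> B) \<subseteq> ball y r"
      by (auto simp: B_def chart_inv[OF V(1)])
    ultimately have "Ck_on k (\<psi> ` (V \<inter> B))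
        (\<lambda>x. bump y s ((\<phi> \<circ> inv_into V \<psi>) x) * F ((\<phi> \<circ> inv_into V \<psi>) x))"
      using Ck_on_compose[OF o] by blast
    then have "Ck_on k (\<psi> ` (V \<inter> B)) (?e \<circ> inv_into V \<psi>)"
      by (rule Ck_on_cong[OF o, rotated]) (auto simp: B_def chart_inv[OF V(1)] bump_times_def)
    then show ?thesis using B True by blast
  next
    case False
    have "q \<notin> K"
    proof
      assume "q \<in> K"
      then obtain x where x: "x \<in> cball y s" "q = inv_into U \<phi> x" unfolding K_def by blast
      have "x \<in> \<phi> ` U" "x \<in> ball y r" using x(1) sub r(1) by auto
      then show False
        using False x(2) by (auto simp: B_def inv_into_into f_inv_into_f)
    qed
    have o: "open (\<psi> ` (V \<inter> - K))" using open_chart_image_Int[OF V(1)] K by blast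
    have "Ck_on k (\<psi> ` (V \<inter> - K)) (?e \<circ> inv_into V \<psi>)"
      by (rule Ck_on_cong[OF o _ Ck_on_const[OF o]]) (auto simp: chart_inv[OF V(1)] zero)
    then show ?thesis using \<open>q \<notin> K\<close> K by blast
  qed
qed

section \<open>Derivations at a point\<close>

lemma tangentD:
  assumes "v \<in> T p"
  shows tangent_add: "f \<in> C \<Longrightarrow> g \<in> C \<Longrightarrow> v (\<lambda>q. f q + g q) = v f + v g"
    and tangent_scale: "f \<in> C \<Longrightarrow> v (\<lambda>q. c * f q) = c * v f"
    and tangent_mult: "f \<in> C \<Longrightarrow> g \<in> C \<Longrightarrow> v (\<lambda>q. f q * g q) = v f * g p + f p * v g"
    and tangent_off: "f \<notin> C \<Longrightarrow> v f = 0"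
  using assms unfolding tangent_space_def plus_fun_def times_fun_def by blast+

lemma tangentI:
  assumes "\<And>f g. f \<in> C \<Longrightarrow> g \<in> C \<Longrightarrow> v (\<lambda>q. f q + g q) = v f + v g"
    and "\<And>f c. f \<in> C \<Longrightarrow> v (\<lambda>q. c * f q) = c * v f"
    and "\<And>f g. f \<in> C \<Longrightarrow> g \<in> C \<Longrightarrow> v (\<lambda>q. f q * g q) = v f * g p + f p * v g"
    and "\<And>f. f \<notin> C \<Longrightarrow> v f = 0"
  shows "v \<in> T p"
  using assms unfolding tangent_space_def plus_fun_def times_fun_def by blast

text \<open>The Leibniz rule for the product of 1 with itself gives
  \<open>v 1 = 2 * v 1\<close>.\<close>

lemma tangent_const: "v \<in> T p \<Longrightarrow> v (\<lambda>q. c) = 0"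
  using tangent_mult[of v p "\<lambda>q. 1" "\<lambda>q. 1"] tangent_scale[of v p "\<lambda>q. 1" c] smooth_const[of 1] by simp

lemma tangent_diff: "v \<in> T p \<Longrightarrow> f \<in> C \<Longrightarrow> g \<in> C \<Longrightarrow> v (\<lambda>q. f q - g q) = v f - v g"
  using tangent_add[of v p f "\<lambda>q. -1 * g q"] tangent_scale[of v p g "-1"] smooth_uminus[of g] by simp

lemma tangent_sum:
  assumes "v \<in> T p" "\<And>i. i \<in> I \<Longrightarrow> f i \<in> C"
  shows "v (\<lambda>q. \<Sum>i\<in>I. f i q) = (\<Sum>i\<in>I. v (f i))"
  using assms(2)
proof (induction I rule: infinite_finite_induct)
  case (insert i I)
  then show ?case
    using tangent_add[OF assms(1), of "f i" "\<lambda>q. \<Sum>i\<in>I. f i q"] by (simp add: smooth_sum)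
qed (simp_all add: tangent_const[OF assms(1)])


section \<open>Local frames and tensoriality\<close>

lemma vector_fieldD:
  assumes "X \<in> VF"
  shows vf_tangent: "X p \<in> T p"
    and vf_smooth: "f \<in> C \<Longrightarrow> (\<lambda>p. X p f) \<in> C"
  using assms unfolding vector_fields_def vf_apply_def by auto

lemma vector_fieldI:
  "(\<And>p. X p \<in> T p) \<Longrightarrow> (\<And>f. f \<in> C \<Longrightarrow> (\<lambda>p. X p f) \<in> C) \<Longrightarrow> X \<in> VF"
  unfolding vector_fields_def vf_apply_def by blast

lemma one_formD:
  assumes "\<omega> \<in> \<Omega>"
  shows form_cotangent: "\<omega> p \<in> cotangent_space A p"
    and form_smooth: "X \<in> VF \<Longrightarrow> (\<lambda>p. \<omega> p (X p)) \<in> C"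
  using assms unfolding one_forms_def form_apply_def by auto

lemma one_formI:
  "(\<And>p. \<omega> p \<in> cotangent_space A p) \<Longrightarrow> (\<And>X. X \<in> VF \<Longrightarrow> (\<lambda>p. \<omega> p (X p)) \<in> C) \<Longrightarrow> \<omega> \<in> \<Omega>"
  unfolding one_forms_def form_apply_def by blast

lemma cotangentD:
  assumes "\<omega> \<in> cotangent_space A p"
  shows cotangent_add: "v \<in> T p \<Longrightarrow> w \<in> T p \<Longrightarrow> \<omega> (v + w) = \<omega> v + \<omega> w"
    and cotangent_scale: "v \<in> T p \<Longrightarrow> \<omega> (\<lambda>f. c * v f) = c * \<omega> v"
    and cotangent_off: "v \<notin> T p \<Longrightarrow> \<omega> v = 0"
  using assms unfolding cotangent_space_def by blast+

lemma cotangentI: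
  assumes "\<And>v w. v \<in> T p \<Longrightarrow> w \<in> T p \<Longrightarrow> \<omega> (v + w) = \<omega> v + \<omega> w"
    and "\<And>c v. v \<in> T p \<Longrightarrow> \<omega> (\<lambda>f. c * v f) = c * \<omega> v"
    and "\<And>v. v \<notin> T p \<Longrightarrow> \<omega> v = 0"
  shows "\<omega> \<in> cotangent_space A p"
  using assms unfolding cotangent_space_def by blast

text \<open>Where \<open>\<rho>\<close> is nonzero, this is a frame with its dual coframe, up to the
  factor \<open>\<rho>\<close>. Keeping the weight makes both identities valid at every point, so
  they can be used as equations between global fields.\<close>

definition is_local_frame :: "('a \<Rightarrow> real) \<Rightarrow> ('n \<Rightarrow> 'a vfield) \<Rightarrow> ('n \<Rightarrow> 'a oneform) \<Rightarrow> bool" where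
  "is_local_frame \<rho> E \<theta> \<longleftrightarrow> \<rho> \<in> C \<and> (\<forall>i. E i \<in> VF) \<and> (\<forall>i. \<theta> i \<in> \<Omega>) \<and>
     (\<forall>q. \<forall>v\<in>T q. \<forall>f. \<rho> q * v f = (\<Sum>i\<in>UNIV. \<theta> i q v * E i q f)) \<and>
     (\<forall>q i j. \<theta> j q (E i q) = (if i = j then \<rho> q else 0))"

lemma is_local_frameD:
  assumes "is_local_frame \<rho> E \<theta>"
  shows frame_weight: "\<rho> \<in> C" and frame_vf: "E i \<in> VF" and frame_form: "\<theta> i \<in> \<Omega>"
    and frame_expansion: "v \<in> T q \<Longrightarrow> \<rho> q * v f = (\<Sum>i\<in>UNIV. \<theta> i q v * E i q f)"
    and frame_dual: "\<theta> j q (E i q) = (if i = j then \<rho> q else 0)"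
  using assms unfolding is_local_frame_def by auto

text \<open>
  On the domain of a chart \<open>\<phi>\<close> around \<open>p\<close> with a bump function \<open>b\<close>, take \<open>E\<^sub>i = b \<partial>\<^sub>i\<close>,
  \<open>\<theta>\<^sub>i = b d(b \<phi>\<^sub>i) - b \<phi>\<^sub>i db = b\<^sup>2 d\<phi>\<^sub>i\<close> and \<open>\<rho> = b\<^sup>3\<close>.  All of these are global objects, so vector fields
  and forms never have to be restricted to open subsets.
\<close>

lemma local_frame:
  obtains \<rho> E \<theta> where "is_local_frame \<rho> E \<theta>" "\<rho> p \<noteq> 0"
proof -
  obtain U \<phi> where U: "(U, \<phi>) \<in> A" "p \<in> U" by (rule obtain_chart)
  define y where "y = \<phi> p"
  have "y \<in> \<phi> ` U" using U(2) by (simp add: y_def)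
  then obtain r where r: "r > 0" "ball y r \<subseteq> \<phi> ` U"
    using open_chart_image[OF U(1)] by (auto simp: open_contains_ball)
  define s where "s = r / 2"
  have s: "0 < s" "s < r" using r by (auto simp: s_def)
  define b where "b = bump_times (U, \<phi>) y s (\<lambda>x. 1)"
  define \<xi> where "\<xi> i = bump_times (U, \<phi>) y s (\<lambda>x. x $ i)" for i
  define pd where "pd i f x = frechet_derivative (f \<circ> inv_into U \<phi>) (at x) (axis i (1::real))"
    for i and f :: "'a \<Rightarrow> real" and x
  define E where "E i q f = (if f \<in> C then bump_times (U, \<phi>) y s (pd i f) q else 0)" for i q f
  define \<theta> where "\<theta> i q v = (if v \<in> T q then b q * v (\<xi> i) - \<xi> i q * v b else 0)" for i q v
  have b: "b \<in> C"
    unfolding b_def by (rule smooth_bump_times[OF U(1) r(2) s Ck_on_const]) simp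
  have \<xi>: "\<xi> i \<in> C" for i
    unfolding \<xi>_def
    by (rule smooth_bump_times[OF U(1) r(2) s
          Ck_on_bounded_linear[OF open_ball bounded_linear_vec_nth Ck_on_ident]]) simp
  have \<xi>_b: "\<xi> i q = b q * \<phi> q $ i" for i q
    by (simp add: \<xi>_def b_def bump_times_def)
  have pd: "bump_times (U, \<phi>) y s (pd i f) \<in> C" if "f \<in> C" for f i
    using smooth_functionsD[OF that U(1), of "Suc _"]
    by (intro smooth_bump_times[OF U(1) r(2) s] Ck_on_subset[OF _ r(2)]) (auto simp: pd_def[abs_def])
  have D: "(f \<circ> inv_into U \<phi> has_derivative frechet_derivative (f \<circ> inv_into U \<phi>) (at (\<phi> q))) (at (\<phi> q))"
    if "f \<in> C" "q \<in> U" for f q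
    using that(2) by (intro Ck_on_SucD[OF smooth_functionsD[OF that(1) U(1), of "Suc 0"]]) auto
  have pd_eq: "pd i f (\<phi> q) = F' (axis i 1)"
    if "(F has_derivative F') (at (\<phi> q))" "\<And>x. x \<in> \<phi> ` U \<Longrightarrow> f (inv_into U \<phi> x) = F x" "q \<in> U" for i f q F F'
  proof -
    have "(f \<circ> inv_into U \<phi> has_derivative F') (at (\<phi> q))"
      by (rule has_derivative_transform_within_open[OF that(1) open_chart_image[OF U(1)]])
        (use that in auto)
    from frechet_derivative_at[OF this] show ?thesis by (simp add: pd_def)
  qed
  have E_tangent: "E i q \<in> T q" for i q
  proof (cases "q \<in> U")
    case True
    have inv: "inv_into U \<phi> (\<phi> q) = q" by (rule chart_inv[OF U(1) True])
    show ?thesis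
    proof (rule tangentI)
      fix f g assume fg: "f \<in> C" "g \<in> C"
      have "pd i (\<lambda>q. f q + g q) (\<phi> q) = pd i f (\<phi> q) + pd i g (\<phi> q)"
        using pd_eq[OF has_derivative_add[OF D[OF fg(1) True] D[OF fg(2) True]], of "\<lambda>q. f q + g q" i] True
        by (simp add: pd_def)
      then show "E i q (\<lambda>q. f q + g q) = E i q f + E i q g"
        using fg True by (simp add: E_def smooth_add bump_times_def distrib_left)
      have "pd i (\<lambda>q. f q * g q) (\<phi> q) = f q * pd i g (\<phi> q) + pd i f (\<phi> q) * g q"
        using pd_eq[OF has_derivative_mult[OF D[OF fg(1) True] D[OF fg(2) True]], of "\<lambda>q. f q * g q" i] True
        by (simp add: pd_def inv)
      then show "E i q (\<lambda>q. f q * g q) = E i q f * g q + f q * E i q g"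
        using fg True by (simp add: E_def smooth_mult bump_times_def algebra_simps)
    next
      fix f c assume f: "f \<in> C"
      have "pd i (\<lambda>q. c * f q) (\<phi> q) = c * pd i f (\<phi> q)"
        using pd_eq[OF has_derivative_mult_right[OF D[OF f True]], of "\<lambda>q. c * f q" c i] True
        by (simp add: pd_def)
      then show "E i q (\<lambda>q. c * f q) = c * E i q f"
        using f True by (simp add: E_def smooth_mult smooth_const bump_times_def)
    qed (simp add: E_def)
  next
    case False
    then have "E i q = (\<lambda>f. 0)" by (auto simp: E_def bump_times_def)
    then show ?thesis by (auto intro: tangentI)
  qed
  have E: "E i \<in> VF" for i
    by (rule vector_fieldI[OF E_tangent]) (simp add: E_def pd)
  have \<theta>: "\<theta> i \<in> \<Omega>" for i
  proof (rule one_formI)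
    fix q
    show "\<theta> i q \<in> cotangent_space A q"
    proof (rule cotangentI)
      fix v w assume v: "v \<in> T q" "w \<in> T q"
      then have "v + w \<in> T q"
        by (intro tangentI) (auto simp: tangentD[OF v(1)] tangentD[OF v(2)] algebra_simps)
      then show "\<theta> i q (v + w) = \<theta> i q v + \<theta> i q w" using v by (simp add: \<theta>_def algebra_simps)
    next
      fix c v assume v: "v \<in> T q"
      then have "(\<lambda>f. c * v f) \<in> T q"
        by (intro tangentI) (auto simp: tangentD[OF v] algebra_simps)
      then show "\<theta> i q (\<lambda>f. c * v f) = c * \<theta> i q v" using v by (simp add: \<theta>_def algebra_simps)
    qed (simp add: \<theta>_def)
  next
    fix X assume X: "X \<in> VF"
    show "(\<lambda>p. \<theta> i p (X p)) \<in> C"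
      using smooth_diff[OF smooth_mult[OF b vf_smooth[OF X \<xi>]] smooth_mult[OF \<xi> vf_smooth[OF X b]]]
      by (simp add: \<theta>_def vf_tangent[OF X])
  qed
  \<comment> \<open>The terms containing the derivative of \<open>b\<close> cancel, leaving one
    factor \<open>b\<close> from \<open>E i\<close> and two from \<open>\<theta> j\<close>.\<close>
  have dual: "\<theta> j q (E i q) = (if i = j then b q ^ 3 else 0)" for i j q
  proof (cases "q \<in> U")
    case True
    define B' where "B' = frechet_derivative (bump y s) (at (\<phi> q))"
    have B': "(bump y s has_derivative B') (at (\<phi> q))"
      unfolding B'_def using Ck_on_SucD[OF Ck_on_bump] by simp
    have bq: "b q = bump y s (\<phi> q)" using True by (simp add: b_def bump_times_def)
    have "pd i b (\<phi> q) = B' (axis i 1)"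
      by (rule pd_eq[OF B' _ True]) (auto simp: b_def bump_times_def chart_inv[OF U(1)])
    then have 1: "E i q b = b q * B' (axis i 1)" using b True bq by (simp add: E_def bump_times_def)
    have "pd i (\<xi> j) (\<phi> q) = bump y s (\<phi> q) * axis i 1 $ j + B' (axis i 1) * \<phi> q $ j"
      by (rule pd_eq[OF has_derivative_mult[OF B' bounded_linear_imp_has_derivative[OF bounded_linear_vec_nth]] _ True])
        (auto simp: \<xi>_def bump_times_def chart_inv[OF U(1)])
    then have 2: "E i q (\<xi> j) = b q * (b q * (if i = j then 1 else 0) + B' (axis i 1) * \<phi> q $ j)"
      using \<xi> True bq by (simp add: E_def bump_times_def axis_def)
    show ?thesis
      by (simp add: \<theta>_def E_tangent 1 2 \<xi>_b) (simp add: algebra_simps power3_eq_cube)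
  next
    case False
    then show ?thesis by (simp add: \<theta>_def b_def \<xi>_def bump_times_def)
  qed
  \<comment> \<open>Hadamard's lemma is applied at the image of the varying point \<open>q\<close>,
    not at the fixed centre \<open>y\<close>. A second bump function \<open>c\<close> around that
    image turns the Hadamard coefficients into global smooth functions, on which \<open>v\<close>
    may act. If \<open>b q = 0\<close> or \<open>f\<close> is not smooth, both sides vanish.\<close>
  have expansion: "b q ^ 3 * v f = (\<Sum>i\<in>UNIV. \<theta> i q v * E i q f)" if v: "v \<in> T q" for q v f
  proof (cases "f \<in> C \<and> b q \<noteq> 0")
    case False
    then show ?thesis
      using tangent_off[OF v] by (cases "f \<in> C") (auto simp: E_def \<theta>_def b_def bump_times_def split: if_splits)
  next
    case True
    then have f: "f \<in> C" and q: "q \<in> U" by (auto simp: b_def bump_times_def split: if_splits)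
    define z where "z = \<phi> q"
    have inv: "inv_into U \<phi> z = q" unfolding z_def by (rule chart_inv[OF U(1) q])
    have "z \<in> \<phi> ` U" using q by (simp add: z_def)
    then obtain r' where r': "r' > 0" "ball z r' \<subseteq> \<phi> ` U"
      using open_chart_image[OF U(1)] by (auto simp: open_contains_ball)
    define s' where "s' = r' / 2"
    have s': "0 < s'" "s' < r'" using r' by (auto simp: s'_def)
    define F where "F = f \<circ> inv_into U \<phi>"
    define g where "g i x = integral {0..1} (\<lambda>t. t ^ 0 * pd i f (z + t *\<^sub>R (x - z)))" for i x
    have CkF: "Ck_on k (ball z r') F" for k
      unfolding F_def using Ck_on_subset[OF smooth_functionsD[OF f U(1)] r'(2)] .
    have g: "Ck_on k (ball z r') (g i)" for k i
      unfolding g_def pd_def F_def[symmetric]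
      by (rule Ck_on_integral_segment) (use CkF[of "Suc k"] in simp)
    have gz: "g i z = pd i f z" for i by (simp add: g_def)
    have hadamard: "F x = F z + (\<Sum>i\<in>UNIV. (x $ i - z $ i) * g i x)" if "x \<in> ball z r'" for x
      using hadamard[OF CkF that]
      by (simp add: sum_Basis_vec inner_axis g_def pd_def F_def)
    define c where "c = bump_times (U, \<phi>) z s' (\<lambda>x. 1)"
    define G where "G i = bump_times (U, \<phi>) z s' (g i)" for i
    have c: "c \<in> C" unfolding c_def by (rule smooth_bump_times[OF U(1) r'(2) s' Ck_on_const]) simp
    have G: "G i \<in> C" for i unfolding G_def by (rule smooth_bump_times[OF U(1) r'(2) s' g])
    have cq: "c q > 0" using q s' by (simp add: c_def bump_times_def z_def bump_pos_iff)
    \<comment> \<open>Multiplication by both bumps makes Hadamard's local expansion an identity of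
      global functions; off the ball of radius \<open>s'\<close>, both \<open>c\<close> and every
      \<open>G i\<close> are 0.\<close>
    have "(b p * c p) * (f p - f q) = (\<Sum>i\<in>UNIV. (\<xi> i p - z $ i * b p) * G i p)" for p
    proof (cases "p \<in> U \<and> \<phi> p \<in> ball z s'")
      case True
      then have "F (\<phi> p) = F z + (\<Sum>i\<in>UNIV. (\<phi> p $ i - z $ i) * g i (\<phi> p))"
        using s' by (intro hadamard) auto
      then have "f p - f q = (\<Sum>i\<in>UNIV. (\<phi> p $ i - z $ i) * g i (\<phi> p))"
        using True by (simp add: F_def inv chart_inv[OF U(1)])
      then show ?thesis
        using True
        by (simp add: c_def G_def bump_times_def \<xi>_b sum_distrib_left algebra_simps)
    next
      case False
      then show ?thesis by (auto simp: c_def G_def bump_times_def bump_zero[OF s'(1)])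
    qed
    then have "v (\<lambda>p. (b p * c p) * (f p - f q)) = v (\<lambda>p. \<Sum>i\<in>UNIV. (\<xi> i p - z $ i * b p) * G i p)"
      by simp
    moreover have "v (\<lambda>p. (b p * c p) * (f p - f q)) = b q * c q * v f"
      using f b c by (simp add: tangent_mult[OF v] tangent_diff[OF v] tangent_const[OF v] smooth_mult
          smooth_diff smooth_const)
    \<comment> \<open>The first factor is \<open>b\<close> times a coordinate difference that
      vanishes at \<open>q\<close>, so only its derivative survives in the Leibniz rule. The second
      factor contributes its value, as the Hadamard coefficient at the centre is the partial
      derivative.\<close>
    moreover have "v (\<lambda>p. (\<xi> i p - z $ i * b p) * G i p) = (v (\<xi> i) - z $ i * v b) * (c q * pd i f z)" for i
    proof -
      have "v (\<lambda>p. (\<xi> i p - z $ i * b p) * G i p)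
          = v (\<lambda>p. \<xi> i p - z $ i * b p) * G i q + (\<xi> i q - z $ i * b q) * v (G i)"
        by (intro tangent_mult[OF v] smooth_diff smooth_mult smooth_const \<xi> b G)
      also have "v (\<lambda>p. \<xi> i p - z $ i * b p) = v (\<xi> i) - z $ i * v b"
        by (simp add: tangent_diff[OF v] tangent_scale[OF v] smooth_mult smooth_const \<xi> b)
      also have "G i q = c q * pd i f z" using q by (simp add: G_def c_def bump_times_def gz flip: z_def)
      also have "\<xi> i q - z $ i * b q = 0" by (simp add: \<xi>_b z_def)
      finally show ?thesis by simp
    qed
    ultimately have "b q * c q * v f = (\<Sum>i\<in>UNIV. (v (\<xi> i) - z $ i * v b) * (c q * pd i f z))"
      using tangent_sum[OF v, of UNIV "\<lambda>i p. (\<xi> i p - z $ i * b p) * G i p"]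
      by (simp add: smooth_diff smooth_mult smooth_const \<xi> b G)
    also have "\<dots> = c q * (\<Sum>i\<in>UNIV. (v (\<xi> i) - z $ i * v b) * pd i f z)"
      by (simp add: sum_distrib_left algebra_simps)
    finally have "b q * v f = (\<Sum>i\<in>UNIV. (v (\<xi> i) - z $ i * v b) * pd i f z)"
      using cq by (simp add: mult.commute mult.left_commute)
    \<comment> \<open>The extra \<open>b\<^sup>2\<close> is shared out: one factor completes
      \<open>\<theta> i\<close> and the other completes \<open>E i\<close>.\<close>
    then have "b q ^ 3 * v f = b q ^ 2 * (\<Sum>i\<in>UNIV. (v (\<xi> i) - z $ i * v b) * pd i f z)"
      by (simp add: power3_eq_cube power2_eq_square)
    also have "\<dots> = (\<Sum>i\<in>UNIV. \<theta> i q v * E i q f)"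
      unfolding sum_distrib_left
    proof (rule sum.cong[OF refl])
      fix i
      have "E i q f = b q * pd i f z" using f q by (simp add: E_def b_def bump_times_def z_def)
      then show "(b q)\<^sup>2 * ((v (\<xi> i) - z $ i * v b) * pd i f z) = \<theta> i q v * E i q f"
        using v by (simp add: \<theta>_def \<xi>_b z_def power2_eq_square algebra_simps)
    qed
    finally show ?thesis .
  qed
  have "(\<lambda>q. b q ^ 3) \<in> C" using b by (auto simp: power3_eq_cube)
  moreover have "b p ^ 3 \<noteq> 0" using U(2) bump_pos_iff[OF s(1), of y y] s
    by (simp add: b_def bump_times_def y_def)
  ultimately show ?thesis
    using E \<theta> expansion dual
    by (intro that[of "\<lambda>q. b q ^ 3" E \<theta>]) (simp_all add: is_local_frame_def)
qed


section \<open>Linear algebra of tangent vectors, vector fields and 1-forms\<close>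

lemma tangent_closed:
  shows tangent_zero: "0 \<in> T p"
    and tangent_plus: "v \<in> T p \<Longrightarrow> w \<in> T p \<Longrightarrow> v + w \<in> T p"
    and tangent_scaled: "v \<in> T p \<Longrightarrow> (\<lambda>f. c * v f) \<in> T p"
proof -
  show "0 \<in> T p" by (auto intro: tangentI)
  show "v + w \<in> T p" if v: "v \<in> T p" "w \<in> T p"
    by (intro tangentI) (auto simp: tangentD[OF v(1)] tangentD[OF v(2)] algebra_simps)
  show "(\<lambda>f. c * v f) \<in> T p" if v: "v \<in> T p"
    by (intro tangentI) (auto simp: tangentD[OF v] algebra_simps)
qed

lemma tangent_minus: "v \<in> T p \<Longrightarrow> w \<in> T p \<Longrightarrow> v - w \<in> T p"
  using tangent_plus[of v p "\<lambda>f. -1 * w f"] tangent_scaled[of w p "-1"]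
  by (simp add: plus_fun_def fun_diff_def)

lemma cotangent_minus_arg:
  assumes "\<omega> \<in> cotangent_space A p" "v \<in> T p" "w \<in> T p"
  shows "\<omega> (v - w) = \<omega> v - \<omega> w"
  using cotangent_add[OF assms(1) tangent_minus[OF assms(2,3)] assms(3)] by simp

lemma cotangent_zero_arg: "\<omega> \<in> cotangent_space A p \<Longrightarrow> \<omega> 0 = 0"
  using cotangent_minus_arg[of \<omega> p 0 0] tangent_zero by simp

lemma tangent_lincomb:
  assumes "\<And>i. i \<in> I \<Longrightarrow> e i \<in> T p"
  shows "(\<lambda>f. \<Sum>i\<in>I. a i * e i f) \<in> T p"
  using assms
proof (induction I rule: infinite_finite_induct)
  case (insert i I)
  then show ?case
    using tangent_plus[of "\<lambda>f. a i * e i f" p "\<lambda>f. \<Sum>i\<in>I. a i * e i f"] tangent_scaled[of "e i" p "a i"]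
    by (simp add: plus_fun_def)
qed (use tangent_zero in \<open>simp_all add: zero_fun_def\<close>)

lemma cotangent_lincomb:
  assumes "\<omega> \<in> cotangent_space A p" "\<And>i. i \<in> I \<Longrightarrow> e i \<in> T p"
  shows "\<omega> (\<lambda>f. \<Sum>i\<in>I. a i * e i f) = (\<Sum>i\<in>I. a i * \<omega> (e i))"
  using assms(2)
proof (induction I rule: infinite_finite_induct)
  case (insert i I)
  then show ?case
    using cotangent_add[OF assms(1), of "\<lambda>f. a i * e i f" "\<lambda>f. \<Sum>i\<in>I. a i * e i f"]
      tangent_scaled[of "e i" p "a i"] tangent_lincomb[of I e p a] cotangent_scale[OF assms(1), of "e i"]
    by (simp add: plus_fun_def)
qed (use cotangent_zero_arg[OF assms(1)] in \<open>simp_all add: zero_fun_def\<close>)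

lemma vf_closed:
  shows vf_zero: "0 \<in> VF"
    and vf_plus: "X \<in> VF \<Longrightarrow> Y \<in> VF \<Longrightarrow> X + Y \<in> VF"
    and vf_minus: "X \<in> VF \<Longrightarrow> Y \<in> VF \<Longrightarrow> X - Y \<in> VF"
    and vf_scale: "f \<in> C \<Longrightarrow> X \<in> VF \<Longrightarrow> scale_vf f X \<in> VF"
proof -
  show "0 \<in> VF" by (rule vector_fieldI) (auto simp: tangent_zero)
  show "X + Y \<in> VF" "X - Y \<in> VF" if "X \<in> VF" "Y \<in> VF"
    by (rule vector_fieldI;
        use vector_fieldD[OF that(1)] vector_fieldD[OF that(2)] tangent_plus tangent_minus in
          \<open>auto intro: smooth_add smooth_diff\<close>)+
  show "scale_vf f X \<in> VF" if "f \<in> C" "X \<in> VF"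
    by (rule vector_fieldI; use vector_fieldD[OF that(2)] tangent_scaled that(1) in
          \<open>auto simp: scale_vf_def intro: smooth_mult\<close>)
qed

lemma vf_sum: "(\<And>i. i \<in> I \<Longrightarrow> X i \<in> VF) \<Longrightarrow> (\<Sum>i\<in>I. X i) \<in> VF"
  by (induction I rule: infinite_finite_induct) (auto intro: vf_zero vf_plus)

lemma frame_span:
  assumes "is_local_frame \<rho> E \<theta>" "\<rho> q \<noteq> 0" "v \<in> T q"
  shows "v = (\<lambda>f. \<Sum>i\<in>UNIV. (\<theta> i q v / \<rho> q) * E i q f)"
proof
  fix f
  have "v f = (\<Sum>i\<in>UNIV. \<theta> i q v * E i q f) / \<rho> q"
    using frame_expansion[OF assms(1,3), of f] assms(2) by (simp add: field_simps)
  then show "v f = (\<Sum>i\<in>UNIV. (\<theta> i q v / \<rho> q) * E i q f)" by (simp add: sum_divide_distrib)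
qed

text \<open>The coefficients of \<open>v\<close> in a frame at \<open>p\<close> are frozen as
  constants; the frame fields are global, so no further cut-off is needed.\<close>

lemma tangent_extend:
  assumes "v \<in> T p"
  obtains X where "X \<in> VF" "X p = v"
proof -
  obtain \<rho> E \<theta> where fr: "is_local_frame \<rho> E \<theta>" "\<rho> p \<noteq> 0" by (rule local_frame)
  note E = frame_vf[OF fr(1)]
  define a where "a i = \<theta> i p v / \<rho> p" for i
  define X where "X = (\<lambda>q f. \<Sum>i\<in>UNIV. a i * E i q f)"
  have "X \<in> VF"
    unfolding X_def
    by (rule vector_fieldI) (auto intro!: tangent_lincomb vf_tangent[OF E] smooth_sum
        smooth_mult[OF smooth_const vf_smooth[OF E]])
  moreover have "X p = v"
    unfolding X_def a_def using frame_span[OF fr assms] by simp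
  ultimately show ?thesis by (rule that)
qed

lemma cotangent_eqI:
  assumes "\<omega> \<in> cotangent_space A p" "\<omega>' \<in> cotangent_space A p" "\<And>v. v \<in> T p \<Longrightarrow> \<omega> v = \<omega>' v"
  shows "\<omega> = \<omega>'"
  using assms cotangent_off by (metis ext)

text \<open>Every tangent vector is the value of a global vector field, so testing on fields is
  testing on all vectors. This supplies the uniqueness behind \<open>nabla_form\<close>.\<close>

lemma one_form_eqI:
  assumes "\<omega> \<in> \<Omega>" "\<omega>' \<in> \<Omega>" "\<And>X. X \<in> VF \<Longrightarrow> form_apply \<omega> X = form_apply \<omega>' X"
  shows "\<omega> = \<omega>'"
proof
  fix p
  show "\<omega> p = \<omega>' p"
  proof (rule cotangent_eqI[OF form_cotangent[OF assms(1)] form_cotangent[OF assms(2)]])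
    fix v assume "v \<in> T p"
    then obtain X where "X \<in> VF" "X p = v" by (rule tangent_extend)
    then show "\<omega> p v = \<omega>' p v" using assms(3)[of X] by (metis form_apply_def)
  qed
qed

lemma one_form_zero: "0 \<in> \<Omega>"
  by (rule one_formI) (auto intro: cotangentI)

lemma one_form_minus:
  assumes "\<omega> \<in> \<Omega>" "\<eta> \<in> \<Omega>"
  shows "\<omega> - \<eta> \<in> \<Omega>"
proof (rule one_formI)
  note c = form_cotangent[OF assms(1)] form_cotangent[OF assms(2)]
  show "(\<omega> - \<eta>) p \<in> cotangent_space A p" for p
    by (rule cotangentI)
      (simp_all add: cotangentD[OF c(1)] cotangentD[OF c(2)] algebra_simps)
  show "(\<lambda>p. (\<omega> - \<eta>) p (X p)) \<in> C" if "X \<in> VF" for X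
    using form_smooth[OF assms(1) that] form_smooth[OF assms(2) that] by auto
qed

text \<open>The fundamental lemma of tensor calculus, and the source of all 1-forms defined by a
  formula on vector fields. Applying \<open>L\<close> to the global expansion of
  \<open>\<rho> X\<close> in a frame and cancelling \<open>\<rho> p\<close> shows that
  \<open>L X p\<close> depends only on \<open>X p\<close>.\<close>

lemma tensorial_form:
  assumes C: "\<And>X. X \<in> VF \<Longrightarrow> L X \<in> C"
    and add: "\<And>X Y. X \<in> VF \<Longrightarrow> Y \<in> VF \<Longrightarrow> L (X + Y) = L X + L Y"
    and scale: "\<And>f X. f \<in> C \<Longrightarrow> X \<in> VF \<Longrightarrow> L (scale_vf f X) = f * L X"
  obtains \<omega> where "\<omega> \<in> \<Omega>" "\<And>X. X \<in> VF \<Longrightarrow> form_apply \<omega> X = L X"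
proof -
  have zero: "L 0 = 0" using add[OF vf_zero vf_zero] by simp
  have sum: "L (\<Sum>i\<in>I. X i) = (\<Sum>i\<in>I. L (X i))" if "\<And>i. i \<in> I \<Longrightarrow> X i \<in> VF"
    for I :: "'n set" and X
    using that
    by (induction I rule: infinite_finite_induct) (auto simp: zero add vf_sum)
  have local: "L X p = L Y p" if XY: "X \<in> VF" "Y \<in> VF" "X p = Y p" for X Y p
  proof -
    obtain \<rho> E \<theta> where fr: "is_local_frame \<rho> E \<theta>" "\<rho> p \<noteq> 0" by (rule local_frame)
    note E = frame_vf[OF fr(1)] and \<theta> = form_smooth[OF frame_form[OF fr(1)]]
    have "\<rho> p * L X p = (\<Sum>i\<in>UNIV. \<theta> i p (X p) * L (E i) p)" if X: "X \<in> VF" for X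
    proof -
      have "scale_vf \<rho> X = (\<Sum>i\<in>UNIV. scale_vf (\<lambda>q. \<theta> i q (X q)) (E i))"
        by (intro ext) (simp add: sum_fun_apply scale_vf_def frame_expansion[OF fr(1) vf_tangent[OF X]])
      then have "L (scale_vf \<rho> X) = (\<Sum>i\<in>UNIV. L (scale_vf (\<lambda>q. \<theta> i q (X q)) (E i)))"
        using sum[of UNIV] vf_scale[OF \<theta>[OF X] E] by simp
      then have "\<rho> * L X = (\<Sum>i\<in>UNIV. (\<lambda>q. \<theta> i q (X q)) * L (E i))"
        by (simp add: scale[OF frame_weight[OF fr(1)] X] scale[OF \<theta>[OF X] E])
      from fun_cong[OF this, of p] show ?thesis by (simp add: sum_fun_apply)
    qed
    from this[OF XY(1)] this[OF XY(2)] have "\<rho> p * L X p = \<rho> p * L Y p" using XY(3) by simp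
    then show ?thesis using fr(2) by simp
  qed
  \<comment> \<open>An arbitrary global extension of each vector; \<open>local\<close> makes the
    choice irrelevant.\<close>
  define ex where "ex p v = (SOME X. X \<in> VF \<and> X p = v)" for p v
  have ex: "ex p v \<in> VF" "ex p v p = v" if "v \<in> T p" for p v
  proof -
    have "\<exists>X. X \<in> VF \<and> X p = v" using tangent_extend[OF that] by blast
    then have "ex p v \<in> VF \<and> ex p v p = v" unfolding ex_def by (rule someI_ex)
    then show "ex p v \<in> VF" "ex p v p = v" by auto
  qed
  define \<omega> where "\<omega> p v = (if v \<in> T p then L (ex p v) p else 0)" for p v
  have \<omega>: "\<omega> p (X p) = L X p" if "X \<in> VF" for X p
    using local[OF ex(1) that ex(2)] vf_tangent[OF that] by (simp add: \<omega>_def)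
  have "\<omega> \<in> \<Omega>"
  proof (rule one_formI)
    show "\<omega> p \<in> cotangent_space A p" for p
    proof (rule cotangentI)
      fix v w assume v: "v \<in> T p" "w \<in> T p"
      then show "\<omega> p (v + w) = \<omega> p v + \<omega> p w"
        using \<omega>[of "ex p v + ex p w" p] \<omega>[of "ex p v" p] \<omega>[of "ex p w" p] ex add vf_plus by simp
    next
      fix c v assume v: "v \<in> T p"
      then show "\<omega> p (\<lambda>f. c * v f) = c * \<omega> p v"
        using \<omega>[of "scale_vf (\<lambda>q. c) (ex p v)" p] \<omega>[of "ex p v" p] ex[OF v]
          scale[OF smooth_const, of "ex p v" c] vf_scale[OF smooth_const, of "ex p v" c]
        by (simp add: scale_vf_def)
    qed (simp add: \<omega>_def)
    show "(\<lambda>p. \<omega> p (X p)) \<in> C" if "X \<in> VF" for X using \<omega>[OF that] C[OF that] by simp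
  qed
  then show ?thesis using that[of \<omega>] \<omega> by (auto simp: form_apply_def)
qed

section \<open>The Lie bracket\<close>

lemma lie_bracket_vf:
  assumes X: "X \<in> VF" and Y: "Y \<in> VF"
  shows "lie_bracket X Y \<in> VF"
proof (rule vector_fieldI)
  fix p
  note x = tangentD[OF vf_tangent[OF X]] and y = tangentD[OF vf_tangent[OF Y]]
  note s = vf_smooth[OF X] vf_smooth[OF Y]
  show "lie_bracket X Y p \<in> T p"
  proof (rule tangentI)
    fix f g assume f: "f \<in> C" and g: "g \<in> C"
    show "lie_bracket X Y p (\<lambda>q. f q + g q) = lie_bracket X Y p f + lie_bracket X Y p g"
      using f g s[OF f] s[OF g] by (simp add: lie_bracket_def vf_apply_def x(1) y(1))
    \<comment> \<open>The two mixed products of first derivatives are symmetric in \<open>Z\<close>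
      and \<open>W\<close>, hence cancel in the commutator.\<close>
    have leibniz: "Z p (\<lambda>q. W q f * g q + f q * W q g)
        = Z p (\<lambda>q. W q f) * g p + W p f * Z p g + (Z p f * W p g + f p * Z p (\<lambda>q. W q g))"
      if Z: "Z \<in> VF" and W: "W \<in> VF" for Z W
      using tangent_add[OF vf_tangent[OF Z] smooth_mult[OF vf_smooth[OF W f] g] smooth_mult[OF f vf_smooth[OF W g]]]
        tangent_mult[OF vf_tangent[OF Z] vf_smooth[OF W f] g] tangent_mult[OF vf_tangent[OF Z] f vf_smooth[OF W g]]
      by simp
    show "lie_bracket X Y p (\<lambda>q. f q * g q) = lie_bracket X Y p f * g p + f p * lie_bracket X Y p g"
      using leibniz[OF X Y] leibniz[OF Y X] f g
      by (simp add: lie_bracket_def vf_apply_def tangent_mult[OF vf_tangent[OF X]]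
          tangent_mult[OF vf_tangent[OF Y]] algebra_simps)
  next
    fix f c assume f: "f \<in> C"
    show "lie_bracket X Y p (\<lambda>q. c * f q) = c * lie_bracket X Y p f"
      using f s[OF f] by (simp add: lie_bracket_def vf_apply_def x(2) y(2) algebra_simps)
  next
    \<comment> \<open>Here \<open>Y\<close> sends \<open>f\<close> to the zero function, which is
      smooth, so the outer vector must be evaluated on a constant.\<close>
    fix f assume "f \<notin> C"
    then show "lie_bracket X Y p f = 0"
      using tangent_const[OF vf_tangent[OF X], of p 0] tangent_const[OF vf_tangent[OF Y], of p 0]
      by (simp add: lie_bracket_def vf_apply_def x(4) y(4))
  qed
next
  fix f assume "f \<in> C"
  then show "(\<lambda>p. lie_bracket X Y p f) \<in> C"
    unfolding lie_bracket_def vf_apply_def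
    by (intro smooth_diff vf_smooth[OF X vf_smooth[OF Y]] vf_smooth[OF Y vf_smooth[OF X]])
qed

end

section \<open>Connections on 1-forms\<close>

locale affine_manifold = manifold +
  fixes nabla
  assumes affine: "affine_connection A nabla"
begin

lemma nabla_vf: "X \<in> VF \<Longrightarrow> Y \<in> VF \<Longrightarrow> nabla X Y \<in> VF"
  using affine unfolding affine_connection_def by blast

lemma nabla_add: "X \<in> VF \<Longrightarrow> Y \<in> VF \<Longrightarrow> Z \<in> VF \<Longrightarrow> nabla X (Y + Z) = nabla X Y + nabla X Z"
  using affine unfolding affine_connection_def by blast

lemma nabla_scale: "f \<in> C \<Longrightarrow> X \<in> VF \<Longrightarrow> Y \<in> VF \<Longrightarrow>
    nabla X (scale_vf f Y) = scale_vf (vf_apply X f) Y + scale_vf f (nabla X Y)"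
  using affine unfolding affine_connection_def by blast

text \<open>The map \<open>L\<close> is function-linear because the term
  \<open>X(f) \<beta>(Y)\<close> arises once from the derivation \<open>X\<close> and once from the
  Leibniz rule of \<open>nabla\<close>, with opposite signs. \<open>tensorial_form\<close> then
  gives existence and \<open>one_form_eqI\<close> uniqueness.\<close>

lemma nabla_form:
  assumes X: "X \<in> VF" and \<beta>: "\<beta> \<in> \<Omega>"
  shows nabla_form_one_form: "nabla_form A nabla X \<beta> \<in> \<Omega>"
    and nabla_form_apply: "Y \<in> VF \<Longrightarrow> form_apply (nabla_form A nabla X \<beta>) Y
      = vf_apply X (form_apply \<beta> Y) - form_apply \<beta> (nabla X Y)"
proof -
  define L where "L Y = vf_apply X (form_apply \<beta> Y) - form_apply \<beta> (nabla X Y)" for Y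
  note x = tangentD[OF vf_tangent[OF X]] and b = cotangentD[OF form_cotangent[OF \<beta>]]
  obtain \<omega> where \<omega>: "\<omega> \<in> \<Omega>" "\<And>Y. Y \<in> VF \<Longrightarrow> form_apply \<omega> Y = L Y"
  proof (rule tensorial_form)
    show "L Y \<in> C" if Y: "Y \<in> VF" for Y
      using smooth_diff[OF vf_smooth[OF X form_smooth[OF \<beta> Y]] form_smooth[OF \<beta> nabla_vf[OF X Y]]]
      by (simp add: L_def vf_apply_def form_apply_def fun_diff_def)
  next
    fix Y Z assume Y: "Y \<in> VF" and Z: "Z \<in> VF"
    have "form_apply \<beta> (Y + Z) = (\<lambda>p. \<beta> p (Y p) + \<beta> p (Z p))" if "Y \<in> VF" "Z \<in> VF" for Y Z
      by (intro ext) (simp add: form_apply_def b vf_tangent that)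
    then show "L (Y + Z) = L Y + L Z"
      using x(1)[OF form_smooth[OF \<beta> Y] form_smooth[OF \<beta> Z]] nabla_add[OF X Y Z]
        nabla_vf[OF X Y] nabla_vf[OF X Z] Y Z
      by (intro ext) (simp add: L_def vf_apply_def form_apply_def)
  next
    fix f Y assume f: "f \<in> C" and Y: "Y \<in> VF"
    have 1: "\<beta> p (scale_vf g Z p) = g p * \<beta> p (Z p)" if "Z \<in> VF" for Z p g
      using b(2)[OF vf_tangent[OF that]] by (simp add: scale_vf_def)
    have Xf: "vf_apply X f \<in> C" using vf_smooth[OF X f] by (simp add: vf_apply_def)
    have "\<beta> p (nabla X (scale_vf f Y) p) = X p f * \<beta> p (Y p) + f p * \<beta> p (nabla X Y p)" for p
      using b(1)[OF vf_tangent vf_tangent, OF vf_scale[OF Xf Y] vf_scale[OF f nabla_vf[OF X Y]], of p]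
      by (simp add: nabla_scale[OF f X Y] 1 Y nabla_vf[OF X Y]) (simp add: vf_apply_def)
    moreover have "X p (\<lambda>p. f p * \<beta> p (Y p)) = X p f * \<beta> p (Y p) + f p * X p (\<lambda>p. \<beta> p (Y p))" for p
      by (rule x(3)[OF f form_smooth[OF \<beta> Y]])
    ultimately show "L (scale_vf f Y) = f * L Y"
      by (intro ext) (simp add: L_def vf_apply_def form_apply_def 1 Y algebra_simps)
  qed (rule that)
  have "nabla_form A nabla X \<beta> = \<omega>"
    unfolding nabla_form_def
    by (rule the_equality) (use \<omega> in \<open>auto simp: L_def intro!: one_form_eqI\<close>)
  with \<omega> show "nabla_form A nabla X \<beta> \<in> \<Omega>"
    "Y \<in> VF \<Longrightarrow> form_apply (nabla_form A nabla X \<beta>) Y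
      = vf_apply X (form_apply \<beta> Y) - form_apply \<beta> (nabla X Y)"
    by (simp_all add: L_def)
qed

lemma curvature_one_form:
  "X \<in> VF \<Longrightarrow> Y \<in> VF \<Longrightarrow> \<gamma> \<in> \<Omega> \<Longrightarrow> curvature lie_bracket (nabla_form A nabla) X Y \<gamma> \<in> \<Omega>"
  unfolding curvature_def by (intro one_form_minus nabla_form_one_form lie_bracket_vf)

text \<open>In the second derivative of \<gamma> the terms with a single \<open>nabla\<close> on
  \<open>Z\<close> are symmetric in \<open>X\<close> and \<open>Y\<close> and drop out; the pure
  derivations cancel against the bracket. The remaining terms appear in reversed order, whence the
  sign.\<close>

lemma curvature_form_apply:
  assumes X: "X \<in> VF" and Y: "Y \<in> VF" and Z: "Z \<in> VF" and \<gamma>: "\<gamma> \<in> \<Omega>"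
  shows "form_apply (curvature lie_bracket (nabla_form A nabla) X Y \<gamma>) Z
    = - form_apply \<gamma> (curvature lie_bracket nabla X Y Z)"
proof
  fix p
  have second: "form_apply (nabla_form A nabla X (nabla_form A nabla Y \<gamma>)) Z p =
      X p (\<lambda>q. Y q (form_apply \<gamma> Z)) - X p (form_apply \<gamma> (nabla Y Z))
      - Y p (form_apply \<gamma> (nabla X Z)) + \<gamma> p (nabla Y (nabla X Z) p)"
    if X: "X \<in> VF" and Y: "Y \<in> VF" for X Y
    using tangent_diff[OF vf_tangent[OF X] vf_smooth[OF Y form_smooth[OF \<gamma> Z]] form_smooth[OF \<gamma> nabla_vf[OF Y Z]], of p]
    by (simp add: nabla_form_apply nabla_form_one_form nabla_vf X Y Z \<gamma> fun_diff_def)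
      (simp add: vf_apply_def form_apply_def)
  have bracket: "form_apply (nabla_form A nabla (lie_bracket X Y) \<gamma>) Z p =
      X p (\<lambda>q. Y q (form_apply \<gamma> Z)) - Y p (\<lambda>q. X q (form_apply \<gamma> Z)) - \<gamma> p (nabla (lie_bracket X Y) Z p)"
    by (simp add: nabla_form_apply lie_bracket_vf X Y Z \<gamma>)
      (simp add: vf_apply_def form_apply_def lie_bracket_def)
  note t = vf_tangent[OF nabla_vf[OF X nabla_vf[OF Y Z]], of p] vf_tangent[OF nabla_vf[OF Y nabla_vf[OF X Z]], of p]
    vf_tangent[OF nabla_vf[OF lie_bracket_vf[OF X Y] Z], of p]
  note c = cotangent_minus_arg[OF form_cotangent[OF \<gamma>]]
  have "form_apply \<gamma> (curvature lie_bracket nabla X Y Z) p =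
      \<gamma> p (nabla X (nabla Y Z) p) - \<gamma> p (nabla Y (nabla X Z) p) - \<gamma> p (nabla (lie_bracket X Y) Z p)"
    using c[OF tangent_minus[OF t(1,2)] t(3)] c[OF t(1,2)]
    by (simp add: curvature_def form_apply_def)
  then show "form_apply (curvature lie_bracket (nabla_form A nabla) X Y \<gamma>) Z p
      = (- form_apply \<gamma> (curvature lie_bracket nabla X Y Z)) p"
    using second[OF X Y] second[OF Y X] bracket
    by (simp add: curvature_def) (simp add: form_apply_def)
qed

end

section \<open>The isomorphism induced by \<open>h\<close>\<close>

locale nondegenerate_manifold = manifold A
  for A :: "('a::{t2_space, second_countable_topology}, 'n::finite) chart set" +
  fixes h :: "'a tensor02"
  assumes tensor: "h \<in> tensor_fields02 A" and nondegenerate: "nondegenerate A h"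
begin

lemma h_cotangent: "v \<in> T p \<Longrightarrow> h p v \<in> cotangent_space A p"
  and h_add: "v \<in> T p \<Longrightarrow> w \<in> T p \<Longrightarrow> h p (v + w) = h p v + h p w"
  and h_scale: "v \<in> T p \<Longrightarrow> h p (\<lambda>f. c * v f) = (\<lambda>w. c * h p v w)"
  and h_smooth: "X \<in> VF \<Longrightarrow> Y \<in> VF \<Longrightarrow> (\<lambda>p. h p (X p) (Y p)) \<in> C"
  using tensor unfolding tensor_fields02_def tensor_apply_def by blast+

lemma h_nondegenerate: "v \<in> T p \<Longrightarrow> (\<And>w. w \<in> T p \<Longrightarrow> h p v w = 0) \<Longrightarrow> v = 0"
  using nondegenerate unfolding nondegenerate_def by blast

lemma h_diff: "v \<in> T p \<Longrightarrow> w \<in> T p \<Longrightarrow> h p (v - w) = h p v - h p w"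
  using h_add[OF tangent_minus, of v p w w] by simp

lemma h_lincomb:
  assumes "\<And>i. i \<in> I \<Longrightarrow> e i \<in> T p"
  shows "h p (\<lambda>f. \<Sum>i\<in>I. a i * e i f) w = (\<Sum>i\<in>I. a i * h p (e i) w)"
  using assms
proof (induction I rule: infinite_finite_induct)
  case (insert i I)
  then show ?case
    using h_add[of "\<lambda>f. a i * e i f" p "\<lambda>f. \<Sum>i\<in>I. a i * e i f"]
      tangent_scaled[of "e i" p "a i"] tangent_lincomb[of I e p a] h_scale[of "e i" p "a i"]
    by (simp add: plus_fun_def)
qed (use h_diff[of 0 p 0] tangent_zero in \<open>simp_all add: zero_fun_def fun_diff_def\<close>)

lemma h_inj: "inj_on (h p) (T p)"
proof (rule inj_onI)
  fix v w assume v: "v \<in> T p" "w \<in> T p" "h p v = h p w"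
  then have "v - w = 0"
    using h_diff[OF v(1,2)] by (intro h_nondegenerate[OF tangent_minus]) auto
  then show "v = w" by simp
qed

lemma flat_one_form: "X \<in> VF \<Longrightarrow> flat h X \<in> \<Omega>"
  unfolding flat_def by (intro one_formI h_cotangent vf_tangent h_smooth)

text \<open>The row index is the second argument of \<open>h\<close>, so
  \<open>gram E q *v a\<close> lists the values of \<open>h\<close> at the combination of the frame
  with coefficients \<open>a\<close>. The order matters when \<open>h\<close> is
  skew-symmetric.\<close>

definition gram :: "('n \<Rightarrow> 'a vfield) \<Rightarrow> 'a \<Rightarrow> real^'n^'n" where
  "gram E q = (\<chi> j i. h q (E i q) (E j q))"

text \<open>A kernel vector of the matrix is a combination of frame vectors that \<open>h\<close>
  pairs to 0 with the whole frame, hence with everything. It vanishes by non-degeneracy, and the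
  dual forms recover its coefficients.\<close>

lemma det_gram_nonzero:
  assumes fr: "is_local_frame \<rho> E \<theta>" "\<rho> q \<noteq> 0"
  shows "det (gram E q) \<noteq> 0"
proof
  note E = vf_tangent[OF frame_vf[OF fr(1)], of _ q]
  assume "det (gram E q) = 0"
  then obtain a where a: "a \<noteq> 0" "gram E q *v a = 0"
    using invertible_det_nz[of "gram E q"] matrix_left_invertible_ker[of "gram E q"]
    by (auto simp: invertible_left_inverse)
  define v where "v = (\<lambda>f. \<Sum>i\<in>UNIV. a $ i * E i q f)"
  have v: "v \<in> T q" unfolding v_def by (rule tangent_lincomb) (rule E)
  have *: "h q v (E j q) = 0" for j
  proof -
    have "h q v (E j q) = (gram E q *v a) $ j"
      unfolding v_def
      by (subst h_lincomb) (auto simp: E matrix_vector_mult_def gram_def mult.commute)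
    then show ?thesis by (simp add: a)
  qed
  have "v = 0"
  proof (rule h_nondegenerate[OF v])
    fix w assume w: "w \<in> T q"
    have "h q v (\<lambda>f. \<Sum>i\<in>UNIV. (\<theta> i q w / \<rho> q) * E i q f) = 0"
      by (subst cotangent_lincomb[OF h_cotangent[OF v]]) (simp_all add: E *)
    then show "h q v w = 0" using frame_span[OF fr w] by simp
  qed
  have "a $ j = 0" for j
  proof -
    note th = form_cotangent[OF frame_form[OF fr(1)]]
    have "\<theta> j q v = a $ j * \<rho> q"
      unfolding v_def
      by (subst cotangent_lincomb[OF th]) (simp_all add: E frame_dual[OF fr(1)] if_distrib cong: if_cong)
    then show ?thesis using \<open>v = 0\<close> cotangent_zero_arg[OF th] fr(2) by simp
  qed
  then show False using a(1) by (simp add: vec_eq_iff)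
qed

text \<open>The preimage of \<omega> is exhibited by determinants rather than merely shown to exist,
  because this formula is what makes its dependence on the point visibly smooth.\<close>

lemma h_cramer:
  fixes \<omega> :: "'a covec" and E :: "'n \<Rightarrow> 'a vfield"
  assumes fr: "is_local_frame \<rho> E \<theta>" "\<rho> q \<noteq> 0" and \<omega>: "\<omega> \<in> cotangent_space A q"
  defines "v \<equiv> (\<lambda>f. \<Sum>k\<in>UNIV.
    (det (\<chi> i j. if j = k then \<omega> (E i q) else gram E q $ i $ j) / det (gram E q)) * E k q f)"
  shows "v \<in> T q" "h q v = \<omega>"
proof -
  note E = vf_tangent[OF frame_vf[OF fr(1)], of _ q]
  define a :: "real^'n" where "a = (\<chi> k. det (\<chi> i j. if j = k then (\<chi> i. \<omega> (E i q)) $ i else gram E q $ i $ j)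
    / det (gram E q))"
  have v_a: "v = (\<lambda>f. \<Sum>k\<in>UNIV. a $ k * E k q f)" by (simp add: v_def a_def cong: if_cong)
  have eq: "gram E q *v a = (\<chi> i. \<omega> (E i q))"
    using cramer[OF det_gram_nonzero[OF fr], of a "\<chi> i. \<omega> (E i q)"] unfolding a_def by blast
  show v: "v \<in> T q" unfolding v_def by (rule tangent_lincomb) (rule E)
  have *: "h q v (E j q) = \<omega> (E j q)" for j
  proof -
    have "h q v (E j q) = (gram E q *v a) $ j"
      unfolding v_a
      by (subst h_lincomb) (auto simp: E matrix_vector_mult_def gram_def mult.commute)
    then show ?thesis by (simp add: eq)
  qed
  show "h q v = \<omega>"
  proof (rule cotangent_eqI[OF h_cotangent[OF v] \<omega>])
    fix w assume w: "w \<in> T q"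
    have "h q v (\<lambda>f. \<Sum>i\<in>UNIV. (\<theta> i q w / \<rho> q) * E i q f)
        = \<omega> (\<lambda>f. \<Sum>i\<in>UNIV. (\<theta> i q w / \<rho> q) * E i q f)"
      by (simp only: cotangent_lincomb[OF h_cotangent[OF v] E] cotangent_lincomb[OF \<omega> E] *)
    then show "h q v w = \<omega> w" using frame_span[OF fr w] by simp
  qed
qed

lemma sharp_eqI: "v \<in> T p \<Longrightarrow> h p v = \<beta> p \<Longrightarrow> sharp A h \<beta> p = v"
  unfolding sharp_def using inv_into_f_f[OF h_inj] by metis

text \<open>Surjectivity justifies reading \<open>inv_into\<close> in \<open>sharp\<close> as a true
  inverse.\<close>

lemma h_surj:
  assumes "\<omega> \<in> cotangent_space A p"
  shows "\<omega> \<in> h p ` T p"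
proof -
  obtain \<rho> E \<theta> where fr: "is_local_frame \<rho> E \<theta>" "\<rho> p \<noteq> 0" by (rule local_frame)
  from h_cramer[OF fr assms] show ?thesis by (intro image_eqI) auto
qed

lemma flat_sharp:
  assumes "\<beta> \<in> \<Omega>"
  shows "flat h (sharp A h \<beta>) = \<beta>"
  unfolding flat_def sharp_def
  by (intro ext) (simp add: f_inv_into_f[OF h_surj[OF form_cotangent[OF assms]]])

lemma sharp_flat: "X \<in> VF \<Longrightarrow> sharp A h (flat h X) = X"
  by (intro ext fun_cong[OF sharp_eqI]) (simp_all add: vf_tangent flat_def)

lemma smooth_det: "(\<And>i j. M i j \<in> C) \<Longrightarrow> (\<lambda>q. det (\<chi> i j. M i j q)) \<in> C"
  by (simp add: det_def) (intro smooth_sum smooth_mult smooth_prod smooth_const)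

lemma sharp_vf:
  assumes \<beta>: "\<beta> \<in> \<Omega>"
  shows "sharp A h \<beta> \<in> VF"
proof (rule vector_fieldI)
  show "sharp A h \<beta> p \<in> T p" for p
    unfolding sharp_def by (rule inv_into_into[OF h_surj[OF form_cotangent[OF \<beta>]]])
next
  fix f assume f: "f \<in> C"
  show "(\<lambda>p. sharp A h \<beta> p f) \<in> C"
  proof (rule smooth_quotient)
    fix p
    obtain \<rho> E \<theta> where fr: "is_local_frame \<rho> E \<theta>" "\<rho> p \<noteq> 0" by (rule local_frame)
    note E = frame_vf[OF fr(1)]
    define D where "D k q = det (\<chi> i j. if j = k then \<beta> q (E i q) else gram E q $ i $ j)" for k q
    \<comment> \<open>\<open>smooth_quotient\<close> demands its identity wherever \<open>d\<close>
      is nonzero, not only at \<open>p\<close>. The factor \<open>\<rho>\<close> ensures that the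
      frame is usable at all such points, and \<open>g\<close> carries the same factor.\<close>
    define d where "d q = \<rho> q * det (gram E q)" for q
    define g where "g q = \<rho> q * (\<Sum>k\<in>UNIV. D k q * E k q f)" for q
    have "D k = (\<lambda>q. det (\<chi> i j. if j = k then \<beta> q (E i q) else h q (E j q) (E i q)))" for k
      by (simp add: D_def[abs_def] gram_def cong: if_cong)
    moreover have "(\<lambda>q. if j = k then \<beta> q (E i q) else h q (E j q) (E i q)) \<in> C" for i j k
      using form_smooth[OF \<beta> E] h_smooth[OF E E] by (cases "j = k") simp_all
    ultimately have D: "D k \<in> C" for k by (simp add: smooth_det)
    have "(\<lambda>q. det (gram E q)) \<in> C"
      unfolding gram_def by (rule smooth_det) (rule h_smooth[OF E E])
    then have "d \<in> C" "g \<in> C"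
      unfolding d_def[abs_def] g_def[abs_def]
      by (intro smooth_mult smooth_sum D frame_weight[OF fr(1)] vf_smooth[OF E f]; assumption)+
    moreover have "d p \<noteq> 0" using fr(2) det_gram_nonzero[OF fr] by (simp add: d_def)
    moreover have "d q * sharp A h \<beta> q f = g q" if "d q \<noteq> 0" for q
    proof -
      have \<rho>: "\<rho> q \<noteq> 0" and det: "det (gram E q) \<noteq> 0" using that by (auto simp: d_def)
      have "sharp A h \<beta> q f = (\<Sum>k\<in>UNIV. D k q / det (gram E q) * E k q f)"
        using sharp_eqI[of _ q \<beta>, OF h_cramer[OF fr(1) \<rho> form_cotangent[OF \<beta>]]]
        unfolding D_def by simp
      also have "\<dots> = (\<Sum>k\<in>UNIV. D k q * E k q f) / det (gram E q)"
        by (simp add: sum_divide_distrib)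
      finally show ?thesis using det by (simp add: d_def g_def)
    qed
    ultimately show "\<exists>d\<in>C. \<exists>g\<in>C. d p \<noteq> 0 \<and> (\<forall>q. d q \<noteq> 0 \<longrightarrow> d q * sharp A h \<beta> q f = g q)" by blast
  qed
qed

lemma flat_diff: "X \<in> VF \<Longrightarrow> Y \<in> VF \<Longrightarrow> flat h (X - Y) = flat h X - flat h Y"
  by (intro ext) (simp add: flat_def h_diff vf_tangent)

lemma sharp_diff:
  assumes "\<beta> \<in> \<Omega>" "\<gamma> \<in> \<Omega>"
  shows "sharp A h (\<beta> - \<gamma>) = sharp A h \<beta> - sharp A h \<gamma>"
proof -
  have "flat h (sharp A h \<beta> - sharp A h \<gamma>) = \<beta> - \<gamma>"
    by (simp add: flat_diff sharp_vf flat_sharp assms)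
  then show ?thesis using sharp_flat[OF vf_minus[OF sharp_vf[OF assms(1)] sharp_vf[OF assms(2)]]] by simp
qed

lemma flat_zero: "flat h 0 = 0" and sharp_zero: "sharp A h 0 = 0"
  using flat_diff[OF vf_zero vf_zero] sharp_diff[OF one_form_zero one_form_zero] by simp_all

end

section \<open>The dual connection\<close>

text \<open>The sign \<open>\<epsilon>\<close> is \<open>1\<close> for symmetric and \<open>-1\<close> for skew-symmetric \<open>h\<close>.\<close>

locale signed_metric_connection = nondegenerate_manifold A h + affine_manifold A nabla
  for A :: "('a::{t2_space, second_countable_topology}, 'n::finite) chart set" and h nabla +
  fixes \<epsilon> :: real
  assumes sign: "\<epsilon> * \<epsilon> = 1"
    and h_sign: "v \<in> tangent_space A p \<Longrightarrow> w \<in> tangent_space A p \<Longrightarrow> h p v w = \<epsilon> * h p w v"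
    and h_hat_sign: "h_hat A h (X, \<alpha>) (Y, \<beta>) = (\<lambda>p. - (1/2) * (form_apply \<alpha> Y p + \<epsilon> * form_apply \<beta> X p))"
begin

abbreviation "nabla_star \<equiv> dual_connection A (h_hat A h) (nabla_hat A h nabla)"

text \<open>The two halves of the pairing decouple: the part with \<gamma> is the definition of
  \<open>nabla\<close> on 1-forms, and the part with the test form becomes the same definition for
  \<open>flat h Z\<close> once the test form is written as \<open>flat h B\<close>.\<close>

lemma dual_connection_eq:
  assumes X: "X \<in> VF" and Z: "Z \<in> VF" and \<gamma>: "\<gamma> \<in> \<Omega>"
  shows "nabla_star (X, \<alpha>) (Z, \<gamma>) = (sharp A h (nabla_form A nabla X (flat h Z)), nabla_form A nabla X \<gamma>)"
  unfolding dual_connection_def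
proof (rule the_equality)
  define W where "W = sharp A h (nabla_form A nabla X (flat h Z))"
  define \<delta> where "\<delta> = nabla_form A nabla X \<gamma>"
  have FZ: "nabla_form A nabla X (flat h Z) \<in> \<Omega>"
    by (rule nabla_form_one_form[OF X flat_one_form[OF Z]])
  have W: "W \<in> VF" unfolding W_def by (rule sharp_vf[OF FZ])
  have \<delta>: "\<delta> \<in> \<Omega>" unfolding \<delta>_def by (rule nabla_form_one_form[OF X \<gamma>])
  have "h_hat A h (Y, \<beta>) (W, \<delta>) = vf_apply X (h_hat A h (Y, \<beta>) (Z, \<gamma>))
      - h_hat A h (nabla_hat A h nabla (X, \<alpha>) (Y, \<beta>)) (Z, \<gamma>)"
    if Y: "Y \<in> VF" and \<beta>: "\<beta> \<in> \<Omega>" for Y \<beta>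
  proof
    fix p
    define B where "B = sharp A h \<beta>"
    have B: "B \<in> VF" unfolding B_def by (rule sharp_vf[OF \<beta>])
    \<comment> \<open>Since \<open>B\<close> sits in the first argument of \<open>h\<close>, while
      \<open>flat h Z\<close> is to be evaluated on \<open>B\<close>, the arguments are exchanged at
      the cost of \<open>\<epsilon>\<close>.\<close>
    have \<beta>_B: "\<beta> q w = \<epsilon> * h q w (B q)" if "w \<in> T q" for q w
      using fun_cong[OF flat_sharp[OF \<beta>], of q] h_sign[OF vf_tangent[OF B] that]
      by (simp add: flat_def B_def)
    have "form_apply (nabla_form A nabla X (flat h Z)) B p
        = X p (\<lambda>q. h q (Z q) (B q)) - h p (Z p) (nabla X B p)"
      by (simp add: nabla_form_apply X flat_one_form Z B)
        (simp add: vf_apply_def form_apply_def flat_def)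
    moreover have "form_apply (nabla_form A nabla X (flat h Z)) B p = h p (W p) (B p)"
      using fun_cong[OF flat_sharp[OF FZ], of p] by (simp add: W_def flat_def form_apply_def)
    ultimately have hW: "h p (W p) (B p) = X p (\<lambda>q. h q (Z q) (B q)) - h p (Z p) (nabla X B p)" by simp
    have "form_apply \<beta> Z = (\<lambda>q. \<epsilon> * h q (Z q) (B q))"
      by (rule ext) (simp only: form_apply_def \<beta>_B[OF vf_tangent[OF Z]])
    then have XB: "X p (form_apply \<beta> Z) = \<epsilon> * X p (\<lambda>q. h q (Z q) (B q))"
      using tangent_scale[OF vf_tangent[OF X] h_smooth[OF Z B], of p \<epsilon>]
      by simp
    have hB: "h p (nabla X B p) (Z p) = \<epsilon> * h p (Z p) (nabla X B p)"
      by (rule h_sign[OF vf_tangent[OF nabla_vf[OF X B]] vf_tangent[OF Z]])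
    \<comment> \<open>Each of the three terms carries exactly one factor \<open>\<epsilon>\<close>,
      so one computation serves both symmetries.\<close>
    have 1: "form_apply \<beta> W p = X p (form_apply \<beta> Z) - h p (nabla X B p) (Z p)"
      unfolding XB hB by (simp add: form_apply_def \<beta>_B vf_tangent[OF W] hW right_diff_distrib)
    have 2: "form_apply \<delta> Y p = X p (form_apply \<gamma> Y) - form_apply \<gamma> (nabla X Y) p"
      unfolding \<delta>_def by (simp add: nabla_form_apply X \<gamma> Y vf_apply_def)
    have s: "form_apply \<beta> Z \<in> C" "form_apply \<gamma> Y \<in> C"
      using form_smooth[OF \<beta> Z] form_smooth[OF \<gamma> Y] by (simp_all add: form_apply_def[abs_def])
    have "X p (\<lambda>q. - (1/2) * (form_apply \<beta> Z q + \<epsilon> * form_apply \<gamma> Y q))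
        = - (1/2) * (X p (form_apply \<beta> Z) + \<epsilon> * X p (form_apply \<gamma> Y))"
      using tangent_scale[OF vf_tangent[OF X] smooth_add[OF s(1) smooth_mult[OF smooth_const s(2)]], of p "-(1/2)" \<epsilon>]
        tangent_add[OF vf_tangent[OF X] s(1) smooth_mult[OF smooth_const s(2)], of p \<epsilon>]
        tangent_scale[OF vf_tangent[OF X] s(2), of p \<epsilon>]
      by simp
    then show "h_hat A h (Y, \<beta>) (W, \<delta>) p = (vf_apply X (h_hat A h (Y, \<beta>) (Z, \<gamma>))
      - h_hat A h (nabla_hat A h nabla (X, \<alpha>) (Y, \<beta>)) (Z, \<gamma>)) p"
      by (simp add: h_hat_sign nabla_hat_def vf_apply_def 1 2 flip: B_def)
        (simp add: form_apply_def flat_def field_simps)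
  qed
  note eq = this
  show "(W, \<delta>) \<in> gsections A \<and>
      (\<forall>\<tau>\<in>gsections A. h_hat A h \<tau> (W, \<delta>) = vf_apply (fst (X, \<alpha>)) (h_hat A h \<tau> (Z, \<gamma>))
        - h_hat A h (nabla_hat A h nabla (X, \<alpha>) \<tau>) (Z, \<gamma>))"
    using W \<delta> eq by (auto simp: gsections_def)
  fix \<rho> assume \<rho>: "\<rho> \<in> gsections A \<and>
      (\<forall>\<tau>\<in>gsections A. h_hat A h \<tau> \<rho> = vf_apply (fst (X, \<alpha>)) (h_hat A h \<tau> (Z, \<gamma>))
        - h_hat A h (nabla_hat A h nabla (X, \<alpha>) \<tau>) (Z, \<gamma>))"
  obtain W' \<delta>' where W'\<delta>': "\<rho> = (W', \<delta>')" by (cases \<rho>)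
  then have W': "W' \<in> VF" and \<delta>': "\<delta>' \<in> \<Omega>" using \<rho> by (auto simp: gsections_def)
  \<comment> \<open>Uniqueness is non-degeneracy of the pairing: tests of the form
    \<open>(Y, 0)\<close> isolate the 1-form, and tests \<open>(0, flat h V)\<close> isolate the
    vector field.\<close>
  have H: "h_hat A h (Y, \<beta>) (W', \<delta>') = h_hat A h (Y, \<beta>) (W, \<delta>)" if "Y \<in> VF" "\<beta> \<in> \<Omega>" for Y \<beta>
    using \<rho> that eq[OF that] W'\<delta>' by (auto simp: gsections_def)
  have "\<epsilon> \<noteq> 0" using sign by auto
  have "form_apply \<delta>' Y = form_apply \<delta> Y" if "Y \<in> VF" for Y
  proof
    fix p
    show "form_apply \<delta>' Y p = form_apply \<delta> Y p"
      using fun_cong[OF H[OF that one_form_zero], of p] \<open>\<epsilon> \<noteq> 0\<close>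
      by (simp add: h_hat_sign) (simp add: form_apply_def)
  qed
  then have "\<delta>' = \<delta>" by (rule one_form_eqI[OF \<delta>' \<delta>])
  moreover have "flat h W' = flat h W"
  proof (rule one_form_eqI[OF flat_one_form[OF W'] flat_one_form[OF W]])
    fix V assume V: "V \<in> VF"
    show "form_apply (flat h W') V = form_apply (flat h W) V"
    proof
      fix p
      have "form_apply (flat h V) W' p = form_apply (flat h V) W p"
        using fun_cong[OF H[OF vf_zero flat_one_form[OF V]], of p]
          cotangent_zero_arg[OF form_cotangent[OF \<delta>]] cotangent_zero_arg[OF form_cotangent[OF \<delta>']]
        by (simp add: h_hat_sign) (simp add: form_apply_def)
      then show "form_apply (flat h W') V p = form_apply (flat h W) V p"
        by (simp add: form_apply_def flat_def h_sign[OF vf_tangent[OF W'] vf_tangent[OF V]]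
            h_sign[OF vf_tangent[OF W] vf_tangent[OF V]])
    qed
  qed
  then have "W' = W" using sharp_flat[OF W] sharp_flat[OF W'] by simp
  ultimately show "\<rho> = (W, \<delta>)" using W'\<delta>' by simp
qed

text \<open>In iterated derivatives each inner \<open>flat h\<close> meets the next
  \<open>sharp A h\<close> and they cancel; additivity then pulls the outer \<open>flat h\<close>
  out of the curvature.\<close>

lemma curvature_nabla_hat:
  assumes "X \<in> VF" "Y \<in> VF" "Z \<in> VF" "\<gamma> \<in> \<Omega>"
  shows "curvature (gbracket A nabla) (nabla_hat A h nabla) (X, \<alpha>) (Y, \<beta>) (Z, \<gamma>) =
    (curvature lie_bracket nabla X Y Z, flat h (curvature lie_bracket nabla X Y (sharp A h \<gamma>)))"
  using assms
  by (simp add: curvature_def nabla_hat_def gbracket_def sharp_flat flat_diff vf_minus nabla_vf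
      lie_bracket_vf sharp_vf)

text \<open>The same cancellation with the roles of \<open>flat h\<close> and
  \<open>sharp A h\<close> exchanged, starting from the explicit form of the dual
  connection.\<close>

lemma curvature_nabla_star:
  assumes "X \<in> VF" "Y \<in> VF" "Z \<in> VF" "\<gamma> \<in> \<Omega>"
  shows "curvature (gbracket A nabla) nabla_star (X, \<alpha>) (Y, \<beta>) (Z, \<gamma>) =
    (sharp A h (curvature lie_bracket (nabla_form A nabla) X Y (flat h Z)),
     curvature lie_bracket (nabla_form A nabla) X Y \<gamma>)"
  using assms
  by (simp add: curvature_def gbracket_def dual_connection_eq flat_sharp sharp_diff one_form_minus
      nabla_form_one_form lie_bracket_vf sharp_vf flat_one_form)

text \<open>Flatness of \<open>nabla\<close> is read off the vector component at sections with zero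
  1-form. Conversely, flatness on vector fields passes to 1-forms by duality, and both curvature
  formulas then give 0.\<close>

lemma flat_iff:
  "flat_connection (gsections A) (gbracket A nabla) (nabla_hat A h nabla) \<and>
   flat_connection (gsections A) (gbracket A nabla) nabla_star \<longleftrightarrow>
   flat_connection VF lie_bracket nabla" (is "?hat \<and> ?star \<longleftrightarrow> ?flat")
proof
  assume "?hat \<and> ?star"
  show ?flat
    unfolding flat_connection_def
  proof (intro ballI)
    fix X Y Z assume XYZ: "X \<in> VF" "Y \<in> VF" "Z \<in> VF"
    then have "(X, 0) \<in> gsections A" "(Y, 0) \<in> gsections A" "(Z, 0) \<in> gsections A"
      by (auto simp: gsections_def one_form_zero)
    with \<open>?hat \<and> ?star\<close>
    have "curvature (gbracket A nabla) (nabla_hat A h nabla) (X, 0) (Y, 0) (Z, 0) = 0"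
      unfolding flat_connection_def by blast
    then show "curvature lie_bracket nabla X Y Z = 0"
      by (simp add: curvature_nabla_hat XYZ one_form_zero zero_prod_def)
  qed
next
  assume flat: ?flat
  then have R: "curvature lie_bracket nabla X Y Z = 0" if "X \<in> VF" "Y \<in> VF" "Z \<in> VF" for X Y Z
    using that unfolding flat_connection_def by blast
  have R': "curvature lie_bracket (nabla_form A nabla) X Y \<gamma> = 0"
    if "X \<in> VF" "Y \<in> VF" "\<gamma> \<in> \<Omega>" for X Y \<gamma>
  proof (rule one_form_eqI[OF curvature_one_form[OF that] one_form_zero])
    fix Z assume "Z \<in> VF"
    then show "form_apply (curvature lie_bracket (nabla_form A nabla) X Y \<gamma>) Z = form_apply 0 Z"
      using cotangent_zero_arg[OF form_cotangent[OF that(3)]]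
      by (intro ext) (simp add: curvature_form_apply that R, simp add: form_apply_def)
  qed
  show "?hat \<and> ?star"
    unfolding flat_connection_def gsections_def
    by (auto simp: curvature_nabla_hat curvature_nabla_star R R' sharp_vf flat_one_form flat_zero
        sharp_zero zero_prod_def)
qed

end

theorem proposition3p8:
  fixes A :: "('a::{t2_space, second_countable_topology}, 'n::finite) chart set"
    and h :: "'a tensor02"
    and nabla :: "'a vfield \<Rightarrow> 'a vfield \<Rightarrow> 'a vfield"
  assumes "quasi_statistical_manifold A h nabla"
    and "symmetric_tensor A h \<or> skew_symmetric_tensor A h"
  shows
    "(\<forall>X\<in>vector_fields A. \<forall>Y\<in>vector_fields A. \<forall>Z\<in>vector_fields A.
      \<forall>\<alpha>\<in>one_forms A. \<forall>\<beta>\<in>one_forms A. \<forall>\<gamma>\<in>one_forms A.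
        curvature (gbracket A nabla) (nabla_hat A h nabla) (X, \<alpha>) (Y, \<beta>) (Z, \<gamma>) =
          (curvature lie_bracket nabla X Y Z,
           flat h (curvature lie_bracket nabla X Y (sharp A h \<gamma>))) \<and>
        curvature (gbracket A nabla) (dual_connection A (h_hat A h) (nabla_hat A h nabla))
            (X, \<alpha>) (Y, \<beta>) (Z, \<gamma>) =
          (sharp A h (curvature lie_bracket (nabla_form A nabla) X Y (flat h Z)),
           curvature lie_bracket (nabla_form A nabla) X Y \<gamma>)) \<and>
     (flat_connection (gsections A) (gbracket A nabla) (nabla_hat A h nabla) \<and>
      flat_connection (gsections A) (gbracket A nabla)
        (dual_connection A (h_hat A h) (nabla_hat A h nabla)) \<longleftrightarrow>
      flat_connection (vector_fields A) lie_bracket nabla)"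
proof -
  \<comment> \<open>The case split mirrors the one inside \<open>h_hat\<close>; in the second case
    the assumption leaves only skew symmetry.\<close>
  define \<epsilon> :: real where "\<epsilon> = (if symmetric_tensor A h then 1 else -1)"
  interpret signed_metric_connection A h nabla \<epsilon>
  proof
    show "smooth_manifold A" "h \<in> tensor_fields02 A" "nondegenerate A h" "affine_connection A nabla"
      using assms(1) unfolding quasi_statistical_manifold_def by auto
    show "\<epsilon> * \<epsilon> = 1" by (simp add: \<epsilon>_def)
    show "h p v w = \<epsilon> * h p w v" if "v \<in> tangent_space A p" "w \<in> tangent_space A p" for p v w
      using assms(2) that
      by (auto simp: \<epsilon>_def symmetric_tensor_def skew_symmetric_tensor_def)
    show "h_hat A h (X, \<alpha>) (Y, \<beta>) = (\<lambda>p. - (1/2) * (form_apply \<alpha> Y p + \<epsilon> * form_apply \<beta> X p))" for X \<alpha> Y \<beta>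
      by (simp add: h_hat_def \<epsilon>_def)
  qed
  show ?thesis
    using flat_iff by (simp add: curvature_nabla_hat curvature_nabla_star)
qed

end
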